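(* Let the initial value problem $y'(x)=f(y(x))$, $y(x_0)=y_0$, have a sufficiently smooth solution (with $f$ sufficiently differentiable), and let $p$ be a positive integer. The modified two-derivative diagonally implicit Runge--Kutta method $$Y_i = y_n+\xi_i(\mu)c_{i} h f(y_n)+h^2\sum_{j=1}^{i} a_{ij}(\mu)g(Y_j),\quad i=1,\ldots,s,$$ $$y_{n+1} = y_n+h f(y_n)+h^2\sum_{i=1}^s b_i(\mu)g(Y_i)$$ (with $g(y)=f'(y)f(y)$, $\mu=\mathrm{i}\omega h$) has order of consistency $p$ if $$\Phi(\tau)=\frac{1}{\gamma(\tau)}+\mathcal{O}\left(h^{p+1-\rho(\tau)}\right)\quad (h\to 0)\qquad\text{for all }\tau\in\mathcal{BT}\text{ with }\rho(\tau)\le p,$$ where $\mathcal{BT}$ is the set of bi-coloured rooted trees, and $\rho$, $\gamma$, $\Phi$ are the order, density and elementary weight.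
   Context: Method: $h>0$ is the stepsize, $\omega>0$ a fixed frequency, $\mathrm{i}^2=-1$, $\mu=\mathrm{i}\omega h$; $c_1,\dots,c_s$ are real nodes; the coefficients $\xi_i(\mu),a_{ij}(\mu),b_i(\mu)$ are complex differentiable on their domains (in a neighbourhood of $0$) and even functions of $\mu$; for small $h$ the stages $Y_i$ are the solutions near $y_n$ of the (implicit) stage equations. Order: under the local assumption $y(x_n)=y_n$, put $LTE_n=y(x_n+h)-y_{n+1}$. The method has order (of consistency) $p$ if $LTE_n=\mathcal{O}(h^{p+1})$ as $h\to0$ for sufficiently smooth solutions. Trees: $\mathcal{BT}$ is the set of bi-coloured (black/white) rooted trees defined recursively: the single black vertex $\bullet$ is in $\mathcal{BT}$; the tree $\circ\!\!-\!\!\bullet$ consisting of a black root with a single white child is in $\mathcal{BT}$ (call it $\tau_{(2)}$); and if $\tau_1,\dots,\tau_m\in\mathcal{BT}$ ($m\ge1$), then $[\tau_1,\dots,\tau_m]_2\in\mathcal{BT}$, where $[\tau_1,\dots,\tau_m]_2$ has a black root whose only child is a white vertex, to which the roots of $\tau_1,\dots,\tau_m$ are attached as children (order of branches irrelevant). Order: $\rho(\tau)$ is the number of vertices: $\rho(\bullet)=1$, $\rho(\tau_{(2)})=2$, $\rho([\tau_1,\dots,\tau_m]_2)=2+\sum_{i}\rho(\tau_i)$. Density: $\gamma(\bullet)=1$, $\gamma(\tau_{(2)})=2$, $\gamma(\tau)=\rho(\tau)(\rho(\tau)-1)\gamma(\tau_1)\cdots\gamma(\tau_m)$ for $\tau=[\tau_1,\dots,\tau_m]_2$.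 Elementary weight: $\Phi(\tau_{(2)})=\sum_{i=1}^s b_i(\mu)$ and $\Phi(\tau)=\sum_{i=1}^s b_i(\mu)\Phi_i(\tau_1)\cdots\Phi_i(\tau_m)$ for $\tau=[\tau_1,\dots,\tau_m]_2$, where $\Phi_i(\bullet)=\xi_i(\mu)c_i$, $\Phi_i(\tau_{(2)})=\sum_{j=1}^i a_{ij}(\mu)$, $\Phi_i(\tau)=\sum_{j=1}^i a_{ij}(\mu)\Phi_j(\tau_1)\cdots\Phi_j(\tau_m)$ for $\tau=[\tau_1,\dots,\tau_m]_2$. For $\tau=\bullet$ one puts $\Phi(\bullet)=1$ (the term $hf(y_n)$ of the method), so its condition is trivially satisfied. *)

theory Defs
  imports "HOL-Analysis.Analysis" "HOL-Library.Landau_Symbols" "HOL-Library.Multiset"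
begin

text \<open>One constructor per formation clause: the single black vertex, the tree
  \<open>\<tau>\<^sub>(\<^sub>2\<^sub>)\<close> (black root with a single white child), and \<open>[\<tau>\<^sub>1,\<dots>,\<tau>\<^sub>m]\<^sub>2\<close>. The branches form a
  multiset, since their order is irrelevant. The datatype also contains \<open>Bracket {#}\<close>; the
  requirement \<open>m \<ge> 1\<close> is imposed in the set \<open>BT\<close> below.\<close>

datatype bctree = Bullet | Tau2 | Bracket "bctree multiset"

inductive_set BT :: "bctree set" where
  Bullet: "Bullet \<in> BT"
| Tau2: "Tau2 \<in> BT"
| Bracket: "M \<noteq> {#} \<Longrightarrow> (\<forall>\<tau> \<in> set_mset M. \<tau> \<in> BT) \<Longrightarrow> Bracket M \<in> BT"

primrec tree_order :: "bctree \<Rightarrow> nat" where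
  "tree_order Bullet = 1"
| "tree_order Tau2 = 2"
| "tree_order (Bracket M) = 2 + (\<Sum>n \<in># image_mset tree_order M. n)"

primrec tree_density :: "bctree \<Rightarrow> nat" where
  "tree_density Bullet = 1"
| "tree_density Tau2 = 2"
| "tree_density (Bracket M) =
     tree_order (Bracket M) * (tree_order (Bracket M) - 1) *
     (\<Prod>d \<in># image_mset tree_density M. d)"

text \<open>Stages are numbered \<open>1, \<dots>, s\<close>; the argument of the coefficient functions is
  \<open>\<mu> = \<i>\<omega>h\<close>. Values at other indices are irrelevant.\<close>

record tddirk =
  stages :: nat
  node :: "nat \<Rightarrow> real"
  xi :: "nat \<Rightarrow> complex \<Rightarrow> complex"
  acoef :: "nat \<Rightarrow> nat \<Rightarrow> complex \<Rightarrow> complex"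
  bcoef :: "nat \<Rightarrow> complex \<Rightarrow> complex"

definition even_holomorphic_at_0 :: "(complex \<Rightarrow> complex) \<Rightarrow> bool" where
  "even_holomorphic_at_0 \<phi> \<longleftrightarrow>
     (\<exists>D. open D \<and> 0 \<in> D \<and> \<phi> holomorphic_on D \<and> (\<forall>\<mu>\<in>D. -\<mu> \<in> D \<and> \<phi> (-\<mu>) = \<phi> \<mu>))"

definition admissible_coeffs :: "tddirk \<Rightarrow> bool" where
  "admissible_coeffs m \<longleftrightarrow>
     (\<forall>i\<in>{1..stages m}. even_holomorphic_at_0 (xi m i) \<and> even_holomorphic_at_0 (bcoef m i) \<and>
        (\<forall>j\<in>{1..i}. even_holomorphic_at_0 (acoef m i j)))"

primrec stage_weight :: "tddirk \<Rightarrow> complex \<Rightarrow> bctree \<Rightarrow> nat \<Rightarrow> complex" where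
  "stage_weight m \<mu> Bullet = (\<lambda>i. xi m i \<mu> * of_real (node m i))"
| "stage_weight m \<mu> Tau2 = (\<lambda>i. \<Sum>j=1..i. acoef m i j \<mu>)"
| "stage_weight m \<mu> (Bracket M) =
     (\<lambda>i. \<Sum>j=1..i. acoef m i j \<mu> * (\<Prod>\<phi> \<in># image_mset (stage_weight m \<mu>) M. \<phi> j))"

fun elem_weight :: "tddirk \<Rightarrow> complex \<Rightarrow> bctree \<Rightarrow> complex" where
  "elem_weight m \<mu> Bullet = 1"
| "elem_weight m \<mu> Tau2 = (\<Sum>i=1..stages m. bcoef m i \<mu>)"
| "elem_weight m \<mu> (Bracket M) =
     (\<Sum>i=1..stages m. bcoef m i \<mu> * (\<Prod>\<tau> \<in># M. stage_weight m \<mu> \<tau> i))"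

text \<open>\<open>C_k_on k f U\<close>, for open \<open>U\<close>: all directional derivatives of \<open>f\<close> up to order \<open>k\<close>
  exist (as Frechet derivatives) and are continuous on \<open>U\<close>.\<close>

fun C_k_on :: "nat \<Rightarrow> ('a::real_normed_vector \<Rightarrow> 'b::real_normed_vector) \<Rightarrow> 'a set \<Rightarrow> bool" where
  "C_k_on 0 f U \<longleftrightarrow> continuous_on U f"
| "C_k_on (Suc k) f U \<longleftrightarrow>
     (\<forall>x\<in>U. f differentiable (at x)) \<and>
     (\<forall>v. C_k_on k (\<lambda>x. frechet_derivative f (at x) v) U)"

definition solves_ivp ::
    "(real^'n \<Rightarrow> real^'n) \<Rightarrow> real \<Rightarrow> real^'n \<Rightarrow> real \<Rightarrow> (real \<Rightarrow> real^'n) \<Rightarrow> bool" where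
  "solves_ivp f x0 y0 X y \<longleftrightarrow> y x0 = y0 \<and>
     (\<forall>x\<in>{x0..X}. (y has_vector_derivative f (y x)) (at x within {x0..X}))"

definition second_deriv_field :: "(real^'n \<Rightarrow> real^'n) \<Rightarrow> real^'n \<Rightarrow> real^'n" where
  "second_deriv_field f v = frechet_derivative f (at v) (f v)"

text \<open>The coefficients are complex while the right-hand side is defined on real vectors only.
  The equations of the method are therefore read in the complexification of the state space;
  the stages, at which \<open>g = f' f\<close> is evaluated, are real vectors. If the coefficients are real at
  \<open>\<mu> = \<i>\<omega>h\<close>, this is the usual method on the real state space.\<close>

definition cvec :: "real^'n \<Rightarrow> complex^'n" where
  "cvec v = (\<chi> k. complex_of_real (v $ k))"

definition stage_equations ::
    "tddirk \<Rightarrow> real \<Rightarrow> (real^'n \<Rightarrow> real^'n) \<Rightarrow> real^'n \<Rightarrow> real \<Rightarrow> (nat \<Rightarrow> real^'n) \<Rightarrow> bool" where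
  "stage_equations m \<omega> f yn h Y \<longleftrightarrow>
     (let \<mu> = \<i> * of_real \<omega> * of_real h in
      \<forall>i\<in>{1..stages m}.
        cvec (Y i) = cvec yn
          + (xi m i \<mu> * of_real (node m i) * of_real h) *s cvec (f yn)
          + of_real h ^ 2 *s (\<Sum>j=1..i. acoef m i j \<mu> *s cvec (second_deriv_field f (Y j))))"

definition next_value ::
    "tddirk \<Rightarrow> real \<Rightarrow> (real^'n \<Rightarrow> real^'n) \<Rightarrow> real^'n \<Rightarrow> real \<Rightarrow> (nat \<Rightarrow> real^'n) \<Rightarrow> complex^'n" where
  "next_value m \<omega> f yn h Y =
     (let \<mu> = \<i> * of_real \<omega> * of_real h in
      cvec yn + of_real h *s cvec (f yn)
        + of_real h ^ 2 *s (\<Sum>i=1..stages m. bcoef m i \<mu> *s cvec (second_deriv_field f (Y i))))"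

text \<open>The stages belonging to the step size \<open>h\<close> are \<open>Y h 1, \<dots>, Y h s\<close>. They are the solutions
  near \<open>yn\<close> of the implicit stage equations for small \<open>h > 0\<close>; a solution branch not
  tending to \<open>yn\<close> is excluded.\<close>

definition stages_near ::
    "tddirk \<Rightarrow> real \<Rightarrow> (real^'n \<Rightarrow> real^'n) \<Rightarrow> real^'n \<Rightarrow> (real \<Rightarrow> nat \<Rightarrow> real^'n) \<Rightarrow> bool" where
  "stages_near m \<omega> f yn Y \<longleftrightarrow>
     (\<forall>\<^sub>F h in at_right 0. stage_equations m \<omega> f yn h (Y h)) \<and>
     (\<forall>i\<in>{1..stages m}. ((\<lambda>h. Y h i) \<longlongrightarrow> yn) (at_right 0))"

definition LTE ::
    "tddirk \<Rightarrow> real \<Rightarrow> (real^'n \<Rightarrow> real^'n) \<Rightarrow> (real \<Rightarrow> real^'n) \<Rightarrow> real \<Rightarrow>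
     (real \<Rightarrow> nat \<Rightarrow> real^'n) \<Rightarrow> real \<Rightarrow> complex^'n" where
  "LTE m \<omega> f y xn Y h = cvec (y (xn + h)) - next_value m \<omega> f (y xn) h (Y h)"

text \<open>The localizing assumption is built in: a step from the grid point \<open>xn\<close> starts at
  the exact value \<open>y xn\<close>.\<close>

definition has_consistency_order ::
    "tddirk \<Rightarrow> real \<Rightarrow> (real^'n \<Rightarrow> real^'n) \<Rightarrow> real \<Rightarrow> real \<Rightarrow> (real \<Rightarrow> real^'n) \<Rightarrow> nat \<Rightarrow> bool" where
  "has_consistency_order m \<omega> f x0 X y p \<longleftrightarrow>
     (\<forall>xn\<in>{x0..<X}. \<forall>Y. stages_near m \<omega> f (y xn) Y \<longrightarrow>
        (\<lambda>h. norm (LTE m \<omega> f y xn Y h)) \<in> O[at_right 0](\<lambda>h. h ^ (p + 1)))"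

end

theory Submission
  imports Defs
begin

text \<open>The exact solution satisfies \<open>y'' = g y\<close>, so the stages, the numerical value and the exact
  solution all arise from the Taylor polynomial of \<open>g\<close> at \<open>y x\<^sub>n\<close> by inserting the
  preceding approximation and applying one linear operator: \<open>u \<mapsto> h\<^sup>2 \<Sum>\<^sub>j a\<^sub>i\<^sub>j u\<^sub>j\<close>,
  \<open>u \<mapsto> h\<^sup>2 \<Sum>\<^sub>i b\<^sub>i u\<^sub>i\<close>, or twofold integration. Each operator sends a monomial
  \<open>\<Prod>\<^sub>i w \<tau>\<^sub>i\<close> in the respective weights (\<open>h\<^sup>\<rho> \<Phi>\<^sub>i\<close>, resp. \<open>h\<^sup>\<rho> / \<gamma>\<close>) to the weight of
  \<open>[\<tau>\<^sub>1, \<dots>, \<tau>\<^sub>m]\<^sub>2\<close>. Hence, up to \<open>O(h\<^sup>p\<^sup>+\<^sup>1)\<close>, the numerical and the exact increment are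
  the same linear combination of tree weights, and comparing these weights is the order
  condition. Since only the existence of common coefficients matters, no elementary
  differentials or symmetry factors have to be computed.\<close>

section \<open>Functions of class \<open>C\<^sup>k\<close>\<close>

text \<open>\<open>C_k_on\<close> uses derivatives at \<open>x\<close>, not within \<open>U\<close>.
  As \<open>U\<close> is open, agreement on \<open>U\<close> is agreement near each of its points,
  so all derivatives there coincide.\<close>

lemma C_k_on_cong:
  assumes "open U" and "\<And>x. x \<in> U \<Longrightarrow> f x = g x"
  shows "C_k_on k f U \<longleftrightarrow> C_k_on k g U"
proof (cases k)
  case 0
  then show ?thesis using continuous_on_cong[OF refl assms(2)] by simp
next
  case (Suc l)
  have imp: "C_k_on l f U \<Longrightarrow> C_k_on l g U"
    if "\<And>x. x \<in> U \<Longrightarrow> f x = g x" for l and f g :: "'a \<Rightarrow> 'b"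
    using that
  proof (induction l arbitrary: f g)
    case 0
    then show ?case using continuous_on_cong[OF refl 0(2)] by simp
  next
    case (Suc l)
    have der: "(g has_derivative frechet_derivative f (at x)) (at x)" if "x \<in> U" for x
    proof (rule has_derivative_transform_within_open[OF _ assms(1) that])
      show "(f has_derivative frechet_derivative f (at x)) (at x)"
        using Suc.prems(1) that by (simp add: frechet_derivative_works)
    qed (simp add: Suc.prems)
    have "C_k_on l (\<lambda>x. frechet_derivative g (at x) v) U" for v
    proof (rule Suc.IH)
      show "C_k_on l (\<lambda>x. frechet_derivative f (at x) v) U"
        using Suc.prems(1) by simp
    qed (simp add: frechet_derivative_at[OF der])
    then show ?case
      using der by (auto simp: differentiable_def)
  qed
  show ?thesis
    using imp[of f g k] imp[of g f k] assms(2) by metis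
qed

text \<open>Uniqueness of the Frechet derivative at a point allows any explicit formula
  \<open>f'\<close> to replace the chosen \<open>frechet_derivative\<close> in the
  definition.\<close>

lemma C_k_on_SucI:
  assumes "open U" and "\<And>x. x \<in> U \<Longrightarrow> (f has_derivative f' x) (at x)"
    and "\<And>v. C_k_on k (\<lambda>x. f' x v) U"
  shows "C_k_on (Suc k) f U"
proof -
  have "C_k_on k (\<lambda>x. frechet_derivative f (at x) v) U" for v
    using assms(3)[of v] by (subst C_k_on_cong[OF assms(1), where g = "\<lambda>x. f' x v"])
      (simp_all add: frechet_derivative_at[OF assms(2), symmetric])
  then show ?thesis
    using assms(2) by (auto simp: differentiable_def)
qed

lemma C_k_on_Suc_has_derivative:
  assumes "C_k_on (Suc k) f U" and "x \<in> U"
  shows "(f has_derivative frechet_derivative f (at x)) (at x)"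
  using assms by (simp add: frechet_derivative_works)

lemma C_k_on_SucD: "C_k_on (Suc k) f U \<Longrightarrow> C_k_on k f U"
proof (induction k arbitrary: f)
  case 0
  then show ?case
    by (simp add: differentiable_imp_continuous_on differentiable_on_def
        differentiable_at_withinI)
qed auto

lemma C_k_on_mono: "l \<le> k \<Longrightarrow> C_k_on k f U \<Longrightarrow> C_k_on l f U"
  by (induction rule: inc_induct) (auto dest: C_k_on_SucD simp del: C_k_on.simps)

lemma C_k_on_zero: "C_k_on k (\<lambda>x. 0) U"
  by (induction k) auto

lemma C_k_on_bounded_linear:
  assumes "open U" and L: "bounded_linear L"
  shows "C_k_on k f U \<Longrightarrow> C_k_on k (\<lambda>x. L (f x)) U"
proof (induction k arbitrary: f)
  case 0
  then show ?case by (simp add: bounded_linear.continuous_on[OF L])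
next
  case (Suc k)
  show ?case
  proof (rule C_k_on_SucI[OF assms(1)])
    show "((\<lambda>x. L (f x)) has_derivative (\<lambda>v. L (frechet_derivative f (at x) v))) (at x)"
      if "x \<in> U" for x
      using C_k_on_Suc_has_derivative[OF Suc.prems that]
      by (rule bounded_linear.has_derivative[OF L])
    show "C_k_on k (\<lambda>x. L (frechet_derivative f (at x) v)) U" for v
      using Suc by simp
  qed
qed

lemma C_k_on_add:
  assumes "open U"
  shows "C_k_on k f U \<Longrightarrow> C_k_on k g U \<Longrightarrow> C_k_on k (\<lambda>x. f x + g x) U"
proof (induction k arbitrary: f g)
  case 0
  then show ?case by (simp add: continuous_on_add)
next
  case (Suc k)
  show ?case
  proof (rule C_k_on_SucI[OF assms(1)])
    show "((\<lambda>x. f x + g x) has_derivative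
        (\<lambda>v. frechet_derivative f (at x) v + frechet_derivative g (at x) v)) (at x)"
      if "x \<in> U" for x
      using Suc.prems that by (intro has_derivative_add C_k_on_Suc_has_derivative)
    show "C_k_on k (\<lambda>x. frechet_derivative f (at x) v + frechet_derivative g (at x) v) U" for v
      using Suc by simp
  qed
qed

lemma C_k_on_sum:
  assumes "open U" and "\<And>i. i \<in> I \<Longrightarrow> C_k_on k (f i) U"
  shows "C_k_on k (\<lambda>x. \<Sum>i\<in>I. f i x) U"
  using assms(2)
  by (induction I rule: infinite_finite_induct)
    (simp_all add: C_k_on_zero C_k_on_add[OF assms(1)])

lemma C_k_on_mult:
  fixes f g :: "'a::real_normed_vector \<Rightarrow> 'b::real_normed_algebra"
  assumes "open U"
  shows "C_k_on k f U \<Longrightarrow> C_k_on k g U \<Longrightarrow> C_k_on k (\<lambda>x. f x * g x) U"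
proof (induction k arbitrary: f g)
  case 0
  then show ?case by (simp add: continuous_on_mult)
next
  case (Suc k)
  show ?case
  proof (rule C_k_on_SucI[OF assms(1)])
    show "((\<lambda>x. f x * g x) has_derivative
        (\<lambda>v. f x * frechet_derivative g (at x) v + frechet_derivative f (at x) v * g x)) (at x)"
      if "x \<in> U" for x
      using Suc.prems that by (intro has_derivative_mult C_k_on_Suc_has_derivative)
    show "C_k_on k (\<lambda>x. f x * frechet_derivative g (at x) v + frechet_derivative f (at x) v * g x) U"
      for v
      using Suc.prems C_k_on_SucD[OF Suc.prems(1)] C_k_on_SucD[OF Suc.prems(2)]
      by (intro C_k_on_add[OF assms(1)] Suc.IH) auto
  qed
qed

text \<open>\<open>C_k_on\<close> controls derivatives in fixed directions only, whereas in
  \<open>g\<close> the direction \<open>f x\<close> varies. Expanding \<open>f x\<close> in the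
  standard basis turns \<open>g\<close> into a finite sum of products of components of
  \<open>f\<close> and of its partial derivatives; one order of smoothness is lost.\<close>

lemma C_k_on_second_deriv_field:
  fixes f :: "real^'n \<Rightarrow> real^'n"
  assumes "open U" and f: "C_k_on (Suc k) f U"
  shows "C_k_on k (\<lambda>x. complex_of_real (second_deriv_field f x $ l)) U"
proof -
  let ?L = "\<lambda>b (x::real^'n). complex_of_real (x $ b)"
  let ?D = "\<lambda>b x. frechet_derivative f (at x) (axis b 1)"
  have L: "bounded_linear (?L b)" for b
    by (rule bounded_linear_compose[OF bounded_linear_of_real bounded_linear_vec_nth])
  have "C_k_on k (\<lambda>x. \<Sum>b\<in>UNIV. ?L b (f x) * ?L l (?D b x)) U"
    using f C_k_on_SucD[OF f]
    by (intro C_k_on_sum C_k_on_mult C_k_on_bounded_linear[OF _ L] assms(1)) simp_all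
  also have "?this \<longleftrightarrow> ?thesis"
  proof (rule C_k_on_cong[OF assms(1)])
    fix x assume "x \<in> U"
    then have lin: "linear (frechet_derivative f (at x))"
      using f C_k_on_Suc_has_derivative has_derivative_linear by blast
    have "f x = (\<Sum>b\<in>UNIV. (f x $ b) *\<^sub>R axis b 1)"
      using basis_expansion[of "f x"] by (simp add: scalar_mult_eq_scaleR)
    then have "second_deriv_field f x
        = frechet_derivative f (at x) (\<Sum>b\<in>UNIV. (f x $ b) *\<^sub>R axis b 1)"
      unfolding second_deriv_field_def by (rule arg_cong)
    then have "second_deriv_field f x = (\<Sum>b\<in>UNIV. (f x $ b) *\<^sub>R ?D b x)"
      by (simp add: linear_sum[OF lin] linear_cmul[OF lin])
    then show "(\<Sum>b\<in>UNIV. ?L b (f x) * ?L l (?D b x)) = ?L l (second_deriv_field f x)"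
      by simp
  qed
  finally show ?thesis .
qed

section \<open>Polynomials and Taylor expansion\<close>

text \<open>Polynomials are kept in normal form and as functions of all of \<open>w\<close>, so that the same
  polynomial can be evaluated at real vectors and at the various complex tree weights.\<close>

inductive poly_fun :: "'v set \<Rightarrow> (('v \<Rightarrow> complex) \<Rightarrow> complex) \<Rightarrow> bool" for V where
  zero: "poly_fun V (\<lambda>w. 0)"
| add_monom: "poly_fun V P \<Longrightarrow> set_mset M \<subseteq> V \<Longrightarrow> poly_fun V (\<lambda>w. P w + c * (\<Prod>v\<in>#M. w v))"

text \<open>The order conditions compare weights of single trees, so the final comparison needs a
  linear combination of weights. Nonlinear terms disappear because each monomial becomes the weight
  of one larger tree.\<close>

inductive lin_fun :: "'v set \<Rightarrow> (('v \<Rightarrow> complex) \<Rightarrow> complex) \<Rightarrow> bool" for V where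
  zero: "lin_fun V (\<lambda>w. 0)"
| add_var: "lin_fun V P \<Longrightarrow> v \<in> V \<Longrightarrow> lin_fun V (\<lambda>w. P w + c * w v)"

lemma poly_fun_monom: "set_mset M \<subseteq> V \<Longrightarrow> poly_fun V (\<lambda>w. c * (\<Prod>v\<in>#M. w v))"
  using poly_fun.add_monom[OF poly_fun.zero] by fastforce

lemma poly_fun_const: "poly_fun V (\<lambda>w. c)"
  using poly_fun_monom[of "{#}"] by simp

lemma poly_fun_var: "v \<in> V \<Longrightarrow> poly_fun V (\<lambda>w. w v)"
  using poly_fun_monom[of "{#v#}" V 1] by simp

lemma poly_fun_add:
  assumes "poly_fun V P" and "poly_fun V Q"
  shows "poly_fun V (\<lambda>w. P w + Q w)"
  using assms(2)
proof induction
  case (add_monom Q M c)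
  show ?case
    using poly_fun.add_monom[OF add_monom.IH add_monom.hyps(2), of c] by (simp add: add.assoc)
qed (simp add: assms)

lemma poly_fun_sum:
  "(\<And>i. i \<in> I \<Longrightarrow> poly_fun V (P i)) \<Longrightarrow> poly_fun V (\<lambda>w. \<Sum>i\<in>I. P i w)"
  by (induction I rule: infinite_finite_induct) (simp_all add: poly_fun.zero poly_fun_add)

lemma poly_fun_monom_mult:
  assumes "poly_fun V P" and "set_mset N \<subseteq> V"
  shows "poly_fun V (\<lambda>w. P w * (d * (\<Prod>v\<in>#N. w v)))"
  using assms(1)
proof induction
  case (add_monom P M c)
  have "poly_fun V (\<lambda>w. P w * (d * (\<Prod>v\<in>#N. w v)) + (c * d) * (\<Prod>v\<in>#M + N. w v))"
    using add_monom assms(2) by (intro poly_fun.add_monom) simp_all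
  then show ?case
    by (simp add: algebra_simps)
qed (simp add: poly_fun.zero)

lemma poly_fun_mult:
  assumes "poly_fun V P" and "poly_fun V Q"
  shows "poly_fun V (\<lambda>w. P w * Q w)"
  using assms(2)
proof induction
  case (add_monom Q M c)
  show ?case
    using poly_fun_add[OF add_monom.IH poly_fun_monom_mult[OF assms(1) add_monom.hyps(2), of c]]
    by (simp add: algebra_simps)
qed (simp add: poly_fun.zero)

lemma poly_fun_compose:
  assumes "poly_fun V P" and "\<And>v. v \<in> V \<Longrightarrow> poly_fun V' (Q v)"
  shows "poly_fun V' (\<lambda>w. P (\<lambda>v. Q v w))"
  using assms(1)
proof induction
  case (add_monom P M c)
  have "poly_fun V' (\<lambda>w. \<Prod>v\<in>#M. Q v w)"
    using add_monom.hyps(2)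
    by (induction M) (auto intro: poly_fun_const poly_fun_mult assms(2))
  then show ?case
    by (intro poly_fun_add poly_fun_mult poly_fun_const add_monom.IH)
qed (simp add: poly_fun.zero)

lemma lin_fun_imp_poly_fun: "lin_fun V P \<Longrightarrow> poly_fun V P"
  by (induction rule: lin_fun.induct)
    (intro poly_fun.zero poly_fun_add poly_fun_mult poly_fun_const poly_fun_var; assumption)+

section \<open>Radial antiderivatives and mean value estimates\<close>

lemma has_vector_derivative_power_Suc_div:
  fixes c :: complex
  shows "((\<lambda>t. of_real t ^ Suc n / of_nat (Suc n) * c) has_vector_derivative of_real t ^ n * c)
    (at t)"
proof -
  have "((\<lambda>z. z ^ Suc n) has_field_derivative of_nat (Suc n) * z ^ n) (at z)" for z :: complex
    using DERIV_power[OF DERIV_ident, where n = "Suc n"] by simp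
  then have "((\<lambda>z. z ^ Suc n / of_nat (Suc n) * c) has_field_derivative
      of_nat (Suc n) * z ^ n / of_nat (Suc n) * c) (at z)" for z :: complex
    by (intro DERIV_cmult_right DERIV_cdivide)
  then have "((\<lambda>z. z ^ Suc n / of_nat (Suc n) * c) has_field_derivative z ^ n * c) (at z)" for z
    using of_nat_neq_0[where 'a = complex, of n] by (simp del: of_nat_Suc)
  from has_vector_derivative_real_field[OF this] show ?thesis .
qed

text \<open>On the ray through \<open>w\<close> a monomial of degree \<open>n\<close> scales with
  \<open>t ^ n\<close>. Integrating from 0 gives \<open>t ^ (n + 1) / (n + 1)\<close>, so dividing
  each coefficient by its degree plus one and splitting off one factor \<open>t\<close> yields a
  polynomial that is the same for all rays.\<close>

lemma poly_fun_radial_antiderivative: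
  assumes "poly_fun V P"
  shows "\<exists>Q. poly_fun V Q \<and> (\<forall>w t.
    ((\<lambda>t. of_real t * Q (\<lambda>v. of_real t * w v)) has_vector_derivative
       P (\<lambda>v. of_real t * w v)) (at t))"
  using assms
proof induction
  case zero
  show ?case by (rule exI[of _ "\<lambda>w. 0"]) (auto intro: poly_fun.zero)
next
  case (add_monom P M c)
  obtain Q where Q: "poly_fun V Q" "\<And>w t.
      ((\<lambda>t. of_real t * Q (\<lambda>v. of_real t * w v)) has_vector_derivative
        P (\<lambda>v. of_real t * w v)) (at t)"
    using add_monom.IH by blast
  define n where "n = size M"
  let ?m = "\<lambda>w. \<Prod>v\<in>#M. w v"
  have hom: "(\<Prod>v\<in>#M. x * w v) = x ^ n * ?m w" for x :: complex and w
    unfolding n_def by (induction M) simp_all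
  have "((\<lambda>t. of_real t * (Q (\<lambda>v. of_real t * w v)
        + c / of_nat (Suc n) * (\<Prod>v\<in>#M. of_real t * w v))) has_vector_derivative
      P (\<lambda>v. of_real t * w v) + c * (\<Prod>v\<in>#M. of_real t * w v)) (at t)" for t :: real and w
    using has_vector_derivative_add[OF Q(2)[of w t]
        has_vector_derivative_power_Suc_div[of n "c * ?m w" t]]
    unfolding hom by (simp add: distrib_left mult_ac del: of_nat_Suc)
  then show ?case
    using poly_fun.add_monom[OF Q(1) add_monom.hyps(2), of "c / of_nat (Suc n)"] by blast
qed

text \<open>Differentiability is asked for in the open interval only: the solution may start at an
  endpoint of its interval, where its derivative is one-sided.\<close>

lemma norm_increment_le:
  fixes u :: "real \<Rightarrow> 'a::real_inner"
  assumes "a < b" and "continuous_on {a..b} u"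
    and "\<And>t. a < t \<Longrightarrow> t < b \<Longrightarrow> (u has_vector_derivative u' t) (at t)"
    and "\<And>t. a < t \<Longrightarrow> t < b \<Longrightarrow> norm (u' t) \<le> B"
  shows "norm (u b - u a) \<le> B * (b - a)"
proof -
  obtain t where t: "t \<in> {a<..<b}" and "norm (u b - u a) \<le> norm ((b - a) *\<^sub>R u' t)"
    using mvt_general[OF assms(1,2), of "\<lambda>t s. s *\<^sub>R u' t"] assms(3)
    unfolding has_vector_derivative_def by blast
  note this(2)
  also have "norm ((b - a) *\<^sub>R u' t) \<le> (b - a) * B"
    using assms(1,4) t by (auto intro!: mult_left_mono)
  finally show ?thesis by (simp add: mult.commute)
qed

text \<open>Integration from a zero gains one power of \<open>h\<close>: on \<open>{0..h}\<close>
  the bound \<open>c * t ^ q\<close> for the derivative is at most \<open>c * h ^ q\<close>, and the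
  mean value inequality contributes the length \<open>h\<close>.\<close>

lemma bigo_of_vector_derivative:
  fixes u u' :: "real \<Rightarrow> complex"
  assumes "\<delta> > 0" and "continuous_on {0..\<delta>} u" and "u 0 = 0"
    and der: "\<And>t. 0 < t \<Longrightarrow> t < \<delta> \<Longrightarrow> (u has_vector_derivative u' t) (at t)"
    and "u' \<in> O[at_right 0](\<lambda>h. of_real h ^ q)"
  shows "u \<in> O[at_right 0](\<lambda>h. of_real h ^ Suc q)"
proof -
  obtain c where "c > 0" and "eventually (\<lambda>h. norm (u' h) \<le> c * norm (of_real h ^ q :: complex)) (at_right 0)"
    using assms(5) by (elim landau_o.bigE)
  then obtain \<epsilon> where "\<epsilon> > 0" and
    \<epsilon>: "\<And>h. 0 < h \<Longrightarrow> h < \<epsilon> \<Longrightarrow> norm (u' h) \<le> c * norm (of_real h ^ q :: complex)"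
    unfolding eventually_at_right_field by blast
  have "norm (u h) \<le> c * norm (of_real h ^ Suc q :: complex)"
    if "h > 0" "h < \<delta>" "h < \<epsilon>" for h
  proof -
    have "norm (u' t) \<le> c * h ^ q" if "0 < t" "t < h" for t
    proof -
      have "norm (u' t) \<le> c * t ^ q"
        using \<epsilon>[of t] that \<open>h < \<epsilon>\<close> by (simp add: norm_power)
      also have "\<dots> \<le> c * h ^ q"
        using that \<open>c > 0\<close> by (intro mult_left_mono power_mono) auto
      finally show ?thesis .
    qed
    then have "norm (u h - u 0) \<le> c * h ^ q * (h - 0)"
      using that der by (intro norm_increment_le[where u' = u'] continuous_on_subset[OF assms(2)])
        auto
    then show ?thesis
      using \<open>u 0 = 0\<close> \<open>h > 0\<close> by (simp add: norm_mult norm_power mult_ac)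
  qed
  then have "eventually (\<lambda>h. norm (u h) \<le> c * norm (of_real h ^ Suc q :: complex)) (at_right 0)"
    unfolding eventually_at_right_field using \<open>\<delta> > 0\<close> \<open>\<epsilon> > 0\<close>
    by (intro exI[of _ "min \<delta> \<epsilon>"]) auto
  then show ?thesis by (rule bigoI)
qed

section \<open>Taylor expansion with a polynomial main part\<close>

text \<open>Induction on \<open>q\<close> replaces the explicit Taylor formula: the partial
  derivatives are expanded to order \<open>q\<close>, and integrating these expansions along the
  segment from \<open>a\<close> to \<open>a + v\<close> expands the function itself. The additional
  factor \<open>norm v\<close> comes from the components of \<open>v\<close> in the derivative along
  the segment.\<close>

lemma C_k_on_taylor:
  fixes \<phi> :: "real^'n \<Rightarrow> complex"
  assumes "open U" and "a \<in> U" and "C_k_on q \<phi> U"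
  shows "\<exists>P C d. poly_fun UNIV P \<and> d > 0 \<and>
    (\<forall>v. norm v < d \<longrightarrow> norm (\<phi> (a + v) - P (\<lambda>b. of_real (v $ b))) \<le> C * norm v ^ q)"
  using assms(3)
proof (induction q arbitrary: \<phi>)
  case 0
  \<comment> \<open>At order 0 the remainder only has to be bounded near \<open>a\<close>, so the
    zero polynomial serves.\<close>
  then have "isCont \<phi> a"
    using assms(1,2) by (simp add: continuous_on_eq_continuous_at)
  then obtain d where "d > 0" and d: "\<And>x. dist x a < d \<Longrightarrow> dist (\<phi> x) (\<phi> a) < 1"
    unfolding continuous_at_eps_delta by (metis zero_less_one)
  have "norm (\<phi> (a + v)) \<le> norm (\<phi> a) + 1" if "norm v < d" for v
    using d[of "a + v"] that norm_triangle_ineq2[of "\<phi> (a + v)" "\<phi> a"]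
    by (simp add: dist_norm)
  then show ?case
    using \<open>d > 0\<close> poly_fun.zero[of UNIV] by (intro exI[of _ "\<lambda>w. 0"]) auto
next
  case (Suc q)
  define D where "D b x = frechet_derivative \<phi> (at x) (axis b 1)" for b x
  have "C_k_on q (D b) U" for b
    using Suc.prems unfolding D_def by simp
  then have "\<forall>b. \<exists>P C d. poly_fun UNIV P \<and> d > 0 \<and> (\<forall>v. norm v < d \<longrightarrow>
      norm (D b (a + v) - P (\<lambda>b. of_real (v $ b))) \<le> C * norm v ^ q)"
    by (intro allI Suc.IH)
  then obtain P C d where "\<forall>b. poly_fun UNIV (P b) \<and> d b > 0 \<and> (\<forall>v. norm v < d b \<longrightarrow>
      norm (D b (a + v) - P b (\<lambda>b. of_real (v $ b))) \<le> C b * norm v ^ q)"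
    unfolding choice_iff by blast
  then have P: "\<And>b. poly_fun UNIV (P b)" and d: "\<And>b. d b > 0"
    and C: "\<And>b v. norm v < d b \<Longrightarrow>
      norm (D b (a + v) - P b (\<lambda>b. of_real (v $ b))) \<le> C b * norm v ^ q"
    by blast+
  have "\<forall>b. \<exists>Q. poly_fun UNIV Q \<and> (\<forall>w t.
      ((\<lambda>t. of_real t * Q (\<lambda>v. of_real t * w v)) has_vector_derivative
        P b (\<lambda>v. of_real t * w v)) (at t))"
    by (intro allI poly_fun_radial_antiderivative P)
  then obtain Q where "\<forall>b. poly_fun UNIV (Q b) \<and> (\<forall>w t.
      ((\<lambda>t. of_real t * Q b (\<lambda>v. of_real t * w v)) has_vector_derivative
        P b (\<lambda>v. of_real t * w v)) (at t))"
    unfolding choice_iff by blast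
  then have Q: "\<And>b. poly_fun UNIV (Q b)"
    and dQ: "\<And>b w t. ((\<lambda>t. of_real t * Q b (\<lambda>v. of_real t * w v)) has_vector_derivative
      P b (\<lambda>v. of_real t * w v)) (at t)"
    by blast+
  obtain r where r: "r > 0" "ball a r \<subseteq> U"
    using assms(1,2) openE by blast
  \<comment> \<open>Below this radius all the finitely many expansions are valid and the segment
    from \<open>a\<close> to \<open>a + v\<close> stays in \<open>U\<close>.\<close>
  define \<delta> where "\<delta> = Min (insert r (range d))"
  have \<delta>: "\<delta> > 0" "\<And>b. \<delta> \<le> d b" "\<delta> \<le> r"
    unfolding \<delta>_def using r(1) d by (auto intro: min.coboundedI2)
  \<comment> \<open>Along the ray through \<open>v\<close> the sum becomes that of
    \<open>v $ b\<close> times the radial antiderivative of \<open>P b\<close>; its derivative is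
    the expansion of the derivative of \<open>\<phi>\<close> in direction \<open>v\<close>.\<close>
  let ?R = "\<lambda>w. \<phi> a + (\<Sum>b\<in>UNIV. w b * Q b w)"
  have "norm (\<phi> (a + v) - ?R (\<lambda>b. of_real (v $ b))) \<le> (\<Sum>b\<in>UNIV. \<bar>C b\<bar>) * norm v ^ Suc q"
    if "norm v < \<delta>" for v
  proof -
    let ?w = "\<lambda>t b. of_real t * of_real (v $ b) :: complex"
    \<comment> \<open>The error along the segment: it vanishes at 0, and its value at 1 is the error
      to be bounded.\<close>
    define \<psi> where "\<psi> t = \<phi> (a + t *\<^sub>R v) - ?R (?w t)" for t
    define \<psi>' where
      "\<psi>' t = (\<Sum>b\<in>UNIV. of_real (v $ b) * (D b (a + t *\<^sub>R v) - P b (?w t)))" for t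
    have small: "norm (t *\<^sub>R v) \<le> norm v" if "t \<in> {0..1}" for t
      using that by (simp add: mult_left_le_one_le)
    have der: "(\<psi> has_vector_derivative \<psi>' t) (at t)" if t: "t \<in> {0..1}" for t
    proof -
      have inU: "a + t *\<^sub>R v \<in> U"
        using small[OF t] \<open>norm v < \<delta>\<close> \<delta>(3) r(2) by (intro subsetD[OF r(2)]) (simp add: dist_norm)
      note d\<phi> = C_k_on_Suc_has_derivative[OF Suc.prems inU]
      have lin: "linear (frechet_derivative \<phi> (at (a + t *\<^sub>R v)))"
        using d\<phi> has_derivative_linear by blast
      have "((\<lambda>t. a + t *\<^sub>R v) has_vector_derivative v) (at t)"
        by (auto intro!: derivative_eq_intros)
      from vector_derivative_diff_chain_within[OF this has_derivative_at_withinI[OF d\<phi>]]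
      have "((\<lambda>t. \<phi> (a + t *\<^sub>R v)) has_vector_derivative
          frechet_derivative \<phi> (at (a + t *\<^sub>R v)) v) (at t)"
        by (simp add: o_def)
      moreover have "v = (\<Sum>b\<in>UNIV. (v $ b) *\<^sub>R axis b 1)"
        using basis_expansion[of v] by (simp add: scalar_mult_eq_scaleR)
      then have "frechet_derivative \<phi> (at (a + t *\<^sub>R v)) v
          = frechet_derivative \<phi> (at (a + t *\<^sub>R v)) (\<Sum>b\<in>UNIV. (v $ b) *\<^sub>R axis b 1)"
        by (rule arg_cong)
      then have "frechet_derivative \<phi> (at (a + t *\<^sub>R v)) v
          = (\<Sum>b\<in>UNIV. (v $ b) *\<^sub>R D b (a + t *\<^sub>R v))"
        by (simp add: D_def linear_sum[OF lin] linear_cmul[OF lin])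
      ultimately have 1: "((\<lambda>t. \<phi> (a + t *\<^sub>R v)) has_vector_derivative
          (\<Sum>b\<in>UNIV. of_real (v $ b) * D b (a + t *\<^sub>R v))) (at t)"
        by (simp add: scaleR_conv_of_real)
      have "((\<lambda>t. \<phi> a + (\<Sum>b\<in>UNIV. of_real (v $ b) * (of_real t * Q b (?w t))))
          has_vector_derivative 0 + (\<Sum>b\<in>UNIV. of_real (v $ b) * P b (?w t))) (at t)"
        by (intro has_vector_derivative_add has_vector_derivative_const has_vector_derivative_sum
            has_vector_derivative_mult_right dQ)
      from has_vector_derivative_diff[OF 1 this] show ?thesis
        unfolding \<psi>_def \<psi>'_def by (simp add: sum_subtractf right_diff_distrib mult_ac)
    qed
    have "norm (\<psi>' t) \<le> (\<Sum>b\<in>UNIV. \<bar>C b\<bar>) * norm v ^ Suc q" if t: "t \<in> {0..1}" for t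
    proof -
      have "norm (\<psi>' t) \<le> (\<Sum>b\<in>UNIV. norm v * (\<bar>C b\<bar> * norm v ^ q))"
        unfolding \<psi>'_def
      proof (rule sum_norm_le)
        fix b
        have "norm (D b (a + t *\<^sub>R v) - P b (?w t)) \<le> C b * norm (t *\<^sub>R v) ^ q"
          using C[of "t *\<^sub>R v" b] small[OF t] \<open>norm v < \<delta>\<close> \<delta>(2)[of b] by simp
        also have "\<dots> \<le> \<bar>C b\<bar> * norm v ^ q"
          using small[OF t] by (intro mult_mono power_mono) auto
        finally show "norm (of_real (v $ b) * (D b (a + t *\<^sub>R v) - P b (?w t)))
            \<le> norm v * (\<bar>C b\<bar> * norm v ^ q)"
          using component_le_norm_cart[of v b]
          by (auto simp: norm_mult intro!: mult_mono)
      qed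
      then show ?thesis by (simp add: sum_distrib_left sum_distrib_right mult_ac)
    qed
    moreover have "continuous_on {0..1} \<psi>"
      by (meson der has_vector_derivative_continuous continuous_at_imp_continuous_on)
    ultimately have "norm (\<psi> 1 - \<psi> 0) \<le> (\<Sum>b\<in>UNIV. \<bar>C b\<bar>) * norm v ^ Suc q * (1 - 0)"
      using der by (intro norm_increment_le[where u' = \<psi>']) auto
    then show ?thesis by (simp add: \<psi>_def)
  qed
  moreover have "poly_fun UNIV ?R"
    by (intro poly_fun_add poly_fun_const poly_fun_sum poly_fun_mult poly_fun_var Q) simp
  ultimately show ?case
    using \<delta>(1) by blast
qed

text \<open>The polynomial is fixed before the curve \<open>v\<close>, so one and the same
  polynomial serves all stages and the exact solution. Components of size \<open>O(h)\<close> give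
  \<open>norm (v h) \<le> K * h\<close>, which lies below the Taylor radius once
  \<open>h < d / K\<close>.\<close>

lemma C_k_on_taylor_bigo:
  fixes \<phi> :: "real^'n \<Rightarrow> complex"
  assumes "open U" and "a \<in> U" and "C_k_on q \<phi> U"
  shows "\<exists>P. poly_fun UNIV P \<and>
    (\<forall>v. (\<forall>b. (\<lambda>h. complex_of_real (v h $ b)) \<in> O[at_right 0](\<lambda>h. of_real h)) \<longrightarrow>
      (\<lambda>h. \<phi> (a + v h) - P (\<lambda>b. of_real (v h $ b))) \<in> O[at_right 0](\<lambda>h. of_real h ^ q))"
proof -
  obtain P C d where P: "poly_fun UNIV P" and "d > 0"
    and C: "\<And>v. norm v < d \<Longrightarrow> norm (\<phi> (a + v) - P (\<lambda>b. of_real (v $ b))) \<le> C * norm v ^ q"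
    using C_k_on_taylor[OF assms] by blast
  have "(\<lambda>h. \<phi> (a + v h) - P (\<lambda>b. of_real (v h $ b))) \<in> O[at_right 0](\<lambda>h. of_real h ^ q)"
    if v: "\<And>b. (\<lambda>h. complex_of_real (v h $ b)) \<in> O[at_right 0](\<lambda>h. of_real h)" for v
  proof -
    have "(\<lambda>h. v h $ b) \<in> O[at_right 0](\<lambda>h. h)" for b
      using v[of b] by (simp add: landau_o.big.of_real_iff)
    then have "(\<lambda>h. \<Sum>b\<in>UNIV. \<bar>v h $ b\<bar>) \<in> O[at_right 0](\<lambda>h. h)"
      by (intro big_sum_in_bigo) simp
    then obtain K where "K > 0"
      and K: "eventually (\<lambda>h. norm (\<Sum>b\<in>UNIV. \<bar>v h $ b\<bar>) \<le> K * norm h) (at_right 0)"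
      by (elim landau_o.bigE)
    have pos: "eventually (\<lambda>h. h > 0 \<and> h < d / K) (at_right (0::real))"
      using \<open>d > 0\<close> \<open>K > 0\<close> unfolding eventually_at_right_field
      by (intro exI[of _ "d / K"]) auto
    have "eventually (\<lambda>h. norm (\<phi> (a + v h) - P (\<lambda>b. of_real (v h $ b)))
        \<le> \<bar>C\<bar> * K ^ q * norm (of_real h ^ q :: complex)) (at_right 0)"
      using K pos
    proof eventually_elim
      case (elim h)
      have "norm (v h) \<le> (\<Sum>b\<in>UNIV. \<bar>v h $ b\<bar>)"
        by (rule norm_le_l1_cart)
      also have "\<dots> \<le> K * h"
        using elim by simp
      finally have vh: "norm (v h) \<le> K * h" .
      also have "K * h < d"
        using elim \<open>K > 0\<close> by (simp add: field_simps)
      finally have "norm (\<phi> (a + v h) - P (\<lambda>b. of_real (v h $ b))) \<le> C * norm (v h) ^ q"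
        by (rule C)
      also have "\<dots> \<le> \<bar>C\<bar> * (K * h) ^ q"
        using vh by (intro mult_mono power_mono) auto
      finally show ?case
        using elim by (simp add: norm_power power_mult_distrib mult_ac)
    qed
    then show ?thesis by (rule bigoI)
  qed
  with P show ?thesis by blast
qed

section \<open>Polynomials in bounded functions\<close>

lemma poly_fun_in_bigo_1:
  assumes "poly_fun V P" and u: "\<And>v. v \<in> V \<Longrightarrow> (\<lambda>h. u h v) \<in> O[F](\<lambda>_. 1)"
  shows "(\<lambda>h. P (u h)) \<in> O[F](\<lambda>_. 1)"
  using assms(1)
proof induction
  case (add_monom P M c)
  have "(\<lambda>h. \<Prod>v\<in>#M. u h v) \<in> O[F](\<lambda>_. 1)"
    using add_monom.hyps(2) by (induction M) (auto intro: landau_o.big.mult_in_1 u)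
  then show ?case
    using add_monom.IH by (intro sum_in_bigo landau_o.big.mult_in_1) auto
qed simp

text \<open>Polynomials are Lipschitz on bounded sets. For monomials the factors are exchanged one
  at a time: with \<open>A\<close> and \<open>B\<close> the remaining products,
  \<open>u x * A - w x * B\<close> equals \<open>u x * (A - B) + (u x - w x) * B\<close>.\<close>

lemma poly_fun_diff_in_bigo:
  assumes "poly_fun V P"
    and u: "\<And>v. v \<in> V \<Longrightarrow> (\<lambda>h. u h v) \<in> O[F](\<lambda>_. 1)"
    and w: "\<And>v. v \<in> V \<Longrightarrow> (\<lambda>h. w h v) \<in> O[F](\<lambda>_. 1)"
    and diff: "\<And>v. v \<in> V \<Longrightarrow> (\<lambda>h. u h v - w h v) \<in> O[F](g)"
  shows "(\<lambda>h. P (u h) - P (w h)) \<in> O[F](g)"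
  using assms(1)
proof induction
  case (add_monom P M c)
  have mono: "(\<lambda>h. (\<Prod>v\<in>#M. u h v) - (\<Prod>v\<in>#M. w h v)) \<in> O[F](g)"
    using add_monom.hyps(2)
  proof (induction M)
    case (add x M)
    have "poly_fun V (\<lambda>w. 1 * (\<Prod>v\<in>#M. w v))"
      using add.prems by (intro poly_fun_monom) auto
    from poly_fun_in_bigo_1[OF this w] add.prems
    have "(\<lambda>h. u h x * ((\<Prod>v\<in>#M. u h v) - (\<Prod>v\<in>#M. w h v))
        + (u h x - w h x) * (\<Prod>v\<in>#M. w h v)) \<in> O[F](g)"
      using landau_o.big.mult[OF u[of x] add.IH] landau_o.big.mult[OF diff[of x]]
      by (intro sum_in_bigo) fastforce+
    then show ?case by (simp add: algebra_simps)
  qed simp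
  have "(\<lambda>h. (P (u h) - P (w h)) + c * ((\<Prod>v\<in>#M. u h v) - (\<Prod>v\<in>#M. w h v))) \<in> O[F](g)"
    using mono by (intro sum_in_bigo(1)[OF add_monom.IH]) simp
  then show ?case by (simp add: algebra_simps)
qed simp

section \<open>Weights as curves\<close>

text \<open>With the power of \<open>h\<close> included, the weight of a grafted tree is the
  operator applied to the product of the branch weights: its factor \<open>h ^ 2\<close> accounts
  for the two new vertices.\<close>

definition stage_curve :: "tddirk \<Rightarrow> real \<Rightarrow> nat \<Rightarrow> real \<Rightarrow> bctree \<Rightarrow> complex" where
  "stage_curve m \<omega> i h \<tau> =
     of_real h ^ tree_order \<tau> * stage_weight m (\<i> * of_real \<omega> * of_real h) \<tau> i"

definition final_curve :: "tddirk \<Rightarrow> real \<Rightarrow> real \<Rightarrow> bctree \<Rightarrow> complex" where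
  "final_curve m \<omega> h \<tau> =
     of_real h ^ tree_order \<tau> * elem_weight m (\<i> * of_real \<omega> * of_real h) \<tau>"

definition exact_curve :: "real \<Rightarrow> bctree \<Rightarrow> complex" where
  "exact_curve h \<tau> = of_real h ^ tree_order \<tau> / of_nat (tree_density \<tau>)"

text \<open>\<open>Bracket {#}\<close> is not in \<open>BT\<close>, but \<open>Tau2\<close> has the same order, density and weights.\<close>

definition graft :: "bctree multiset \<Rightarrow> bctree" where
  "graft M = (if M = {#} then Tau2 else Bracket M)"

lemma graft_in_BT: "set_mset M \<subseteq> BT \<Longrightarrow> graft M \<in> BT"
  by (auto simp: graft_def intro: BT.intros)

lemma prod_mset_power_mult:
  fixes x :: "'a::comm_monoid_mult"
  shows "(\<Prod>\<tau>\<in>#M. x ^ f \<tau> * w \<tau>) = x ^ (\<Sum>\<tau>\<in>#M. f \<tau>) * (\<Prod>\<tau>\<in>#M. w \<tau>)"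
  by (induction M) (simp_all add: power_add mult_ac)

lemma tree_order_graft: "tree_order (graft M) = Suc (Suc (\<Sum>\<tau>\<in>#M. tree_order \<tau>))"
  by (simp add: graft_def)

lemma stage_curve_graft:
  "stage_curve m \<omega> i h (graft M) = of_real h ^ 2 *
     (\<Sum>j=1..i. acoef m i j (\<i> * of_real \<omega> * of_real h) * (\<Prod>\<tau>\<in>#M. stage_curve m \<omega> j h \<tau>))"
  unfolding stage_curve_def prod_mset_power_mult tree_order_graft
  by (simp add: graft_def sum_distrib_left power2_eq_square mult_ac multiset.map_comp o_def)

lemma final_curve_graft:
  "final_curve m \<omega> h (graft M) = of_real h ^ 2 *
     (\<Sum>i=1..stages m. bcoef m i (\<i> * of_real \<omega> * of_real h) * (\<Prod>\<tau>\<in>#M. stage_curve m \<omega> i h \<tau>))"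
  unfolding final_curve_def stage_curve_def prod_mset_power_mult tree_order_graft
  by (simp add: graft_def sum_distrib_left power2_eq_square mult_ac)

text \<open>Grafting multiplies the density by \<open>(n + 2) * (n + 1)\<close>, exactly the divisor
  produced by integrating \<open>t ^ n\<close> twice. The quotient is split so that the two
  integrations can be read off separately.\<close>

lemma exact_curve_graft:
  fixes M
  defines "n \<equiv> \<Sum>\<tau>\<in>#M. tree_order \<tau>"
  defines "c \<equiv> \<Prod>\<tau>\<in>#M. 1 / of_nat (tree_density \<tau>)"
  shows "(\<Prod>\<tau>\<in>#M. exact_curve h \<tau>) = of_real h ^ n * c"
    and "exact_curve h (graft M)
      = of_real h ^ Suc (Suc n) / of_nat (Suc (Suc n)) * (c / of_nat (Suc n))"
proof -
  show "(\<Prod>\<tau>\<in>#M. exact_curve h \<tau>) = of_real h ^ n * c"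
    unfolding n_def c_def by (simp add: exact_curve_def flip: prod_mset_power_mult)
  have "c = 1 / of_nat (\<Prod>\<tau>\<in>#M. tree_density \<tau>)"
    unfolding c_def by (induction M) simp_all
  moreover have \<gamma>: "tree_density (graft M) = Suc (Suc n) * Suc n * (\<Prod>\<tau>\<in>#M. tree_density \<tau>)"
    by (simp add: graft_def n_def)
  ultimately show "exact_curve h (graft M)
      = of_real h ^ Suc (Suc n) / of_nat (Suc (Suc n)) * (c / of_nat (Suc n))"
    unfolding exact_curve_def tree_order_graft n_def[symmetric] \<gamma>
    by (simp del: of_nat_Suc power_Suc mult_Suc mult_Suc_right add: mult_ac)
qed

text \<open>\<open>Q\<close> arises from \<open>P\<close> by replacing each monomial with the
  variable of the grafted tree, the constant monomial becoming \<open>Tau2\<close>. This single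
  \<open>Q\<close> realizes all three operators; \<open>e\<close> is the intermediate result after
  the first of the two integrations.\<close>

lemma tree_lift:
  assumes "poly_fun BT P"
  obtains Q e where "lin_fun BT Q"
    and "\<And>h i. Q (stage_curve m \<omega> i h) = of_real h ^ 2 *
      (\<Sum>j=1..i. acoef m i j (\<i> * of_real \<omega> * of_real h) * P (stage_curve m \<omega> j h))"
    and "\<And>h. Q (final_curve m \<omega> h) = of_real h ^ 2 *
      (\<Sum>i=1..stages m. bcoef m i (\<i> * of_real \<omega> * of_real h) * P (stage_curve m \<omega> i h))"
    and "Q (exact_curve 0) = 0" and "e 0 = 0"
    and "\<And>t. ((\<lambda>t. Q (exact_curve t)) has_vector_derivative e t) (at t)"
    and "\<And>t. (e has_vector_derivative P (exact_curve t)) (at t)"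
  using assms
proof (induction arbitrary: thesis)
  case zero
  show ?case
    by (rule zero[of "\<lambda>w. 0" "\<lambda>t. 0"]) (auto intro: lin_fun.zero)
next
  case (add_monom P M c)
  obtain Q e where Q: "lin_fun BT Q"
    and st: "\<And>h i. Q (stage_curve m \<omega> i h) = of_real h ^ 2 *
      (\<Sum>j=1..i. acoef m i j (\<i> * of_real \<omega> * of_real h) * P (stage_curve m \<omega> j h))"
    and fi: "\<And>h. Q (final_curve m \<omega> h) = of_real h ^ 2 *
      (\<Sum>i=1..stages m. bcoef m i (\<i> * of_real \<omega> * of_real h) * P (stage_curve m \<omega> i h))"
    and 0: "Q (exact_curve 0) = 0" "e 0 = 0"
    and d: "\<And>t. ((\<lambda>t. Q (exact_curve t)) has_vector_derivative e t) (at t)"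
      "\<And>t. (e has_vector_derivative P (exact_curve t)) (at t)"
    using add_monom.IH by blast
  define n where "n = (\<Sum>\<tau>\<in>#M. tree_order \<tau>)"
  define k :: complex where "k = (\<Prod>\<tau>\<in>#M. 1 / of_nat (tree_density \<tau>))"
  note ex = exact_curve_graft[where M = M, folded n_def k_def]
  show ?case
  \<comment> \<open>Along the exact weights the new monomial equals \<open>c * t ^ n * k\<close>.
    Its first integral is added to \<open>e\<close>, and its second one is \<open>c\<close> times
    the exact weight of \<open>graft M\<close>.\<close>
  proof (rule add_monom.prems[of "\<lambda>w. Q w + c * w (graft M)"
        "\<lambda>t. e t + c * (of_real t ^ Suc n / of_nat (Suc n) * k)"])
    show "lin_fun BT (\<lambda>w. Q w + c * w (graft M))"
      using Q graft_in_BT add_monom.hyps(2) by (intro lin_fun.add_var)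
    show "Q (stage_curve m \<omega> i h) + c * stage_curve m \<omega> i h (graft M) = of_real h ^ 2 *
        (\<Sum>j=1..i. acoef m i j (\<i> * of_real \<omega> * of_real h) *
          (P (stage_curve m \<omega> j h) + c * (\<Prod>\<tau>\<in>#M. stage_curve m \<omega> j h \<tau>)))" for h i
      unfolding st stage_curve_graft
      by (simp add: distrib_left sum.distrib sum_distrib_left mult_ac)
    show "Q (final_curve m \<omega> h) + c * final_curve m \<omega> h (graft M) = of_real h ^ 2 *
        (\<Sum>i=1..stages m. bcoef m i (\<i> * of_real \<omega> * of_real h) *
          (P (stage_curve m \<omega> i h) + c * (\<Prod>\<tau>\<in>#M. stage_curve m \<omega> i h \<tau>)))" for h
      unfolding fi final_curve_graft
      by (simp add: distrib_left sum.distrib sum_distrib_left mult_ac)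
    show "((\<lambda>t. Q (exact_curve t) + c * exact_curve t (graft M)) has_vector_derivative
        e t + c * (of_real t ^ Suc n / of_nat (Suc n) * k)) (at t)" for t
      using has_vector_derivative_power_Suc_div[of "Suc n" "k / of_nat (Suc n)" t]
      unfolding ex by (intro has_vector_derivative_add d has_vector_derivative_mult_right)
        (simp del: of_nat_Suc power_Suc)
    show "((\<lambda>t. e t + c * (of_real t ^ Suc n / of_nat (Suc n) * k)) has_vector_derivative
        P (exact_curve t) + c * (\<Prod>\<tau>\<in>#M. exact_curve t \<tau>)) (at t)" for t
      unfolding ex by (intro has_vector_derivative_add d has_vector_derivative_mult_right
        has_vector_derivative_power_Suc_div)
  qed (simp_all add: 0 ex del: of_nat_Suc)
qed

section \<open>The local error\<close>

lemma tendsto_imp_bigo_1: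
  fixes f :: "'a \<Rightarrow> 'b::real_normed_field"
  shows "(f \<longlongrightarrow> c) F \<Longrightarrow> f \<in> O[F](\<lambda>_. 1)"
  by (rule bigoI_tendsto[of _ _ c]) simp_all

lemma bigo_eventually_eq:
  "f \<in> O[F](g) \<Longrightarrow> eventually (\<lambda>x. f' x = f x) F \<Longrightarrow> f' \<in> O[F](g)"
  by (subst landau_o.big.in_cong)

lemma power_bigo_at_right_0:
  assumes "q \<le> r"
  shows "(\<lambda>h. of_real h ^ r :: complex) \<in> O[at_right 0](\<lambda>h. of_real h ^ q)"
proof (rule bigoI[of _ 1])
  have "eventually (\<lambda>h. 0 < h \<and> h < 1) (at_right (0::real))"
    unfolding eventually_at_right_field by (intro exI[of _ 1]) auto
  then show "eventually (\<lambda>h. norm (of_real h ^ r :: complex)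
      \<le> 1 * norm (of_real h ^ q :: complex)) (at_right 0)"
    by eventually_elim (use assms in \<open>auto simp: norm_power intro: power_decreasing\<close>)
qed

lemmas bigo_power_mono = landau_o.big_trans[OF _ power_bigo_at_right_0]

lemma even_holomorphic_bigo_1:
  assumes "even_holomorphic_at_0 \<phi>"
  shows "(\<lambda>h. \<phi> (\<i> * of_real \<omega> * of_real h)) \<in> O[at_right 0](\<lambda>_. 1)"
proof -
  obtain D where "open D" "0 \<in> D" "\<phi> holomorphic_on D"
    using assms unfolding even_holomorphic_at_0_def by blast
  then have "isCont \<phi> 0"
    by (meson continuous_on_eq_continuous_at holomorphic_on_imp_continuous_on)
  moreover have "((\<lambda>h. \<i> * of_real \<omega> * of_real h) \<longlongrightarrow> \<i> * of_real \<omega> * of_real 0) (at_right 0)"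
    by (intro tendsto_intros)
  ultimately show ?thesis
    by (intro tendsto_imp_bigo_1[of _ "\<phi> 0"] isCont_tendsto_compose[of 0 \<phi>]) simp_all
qed

text \<open>The stage index is generalized in the induction, since a bracket at stage
  \<open>i\<close> refers to its branches at the stages \<open>j \<le> i\<close>.\<close>

lemma stage_weight_bigo_1:
  assumes "admissible_coeffs m"
  shows "i \<in> {1..stages m} \<Longrightarrow>
    (\<lambda>h. stage_weight m (\<i> * of_real \<omega> * of_real h) \<tau> i) \<in> O[at_right 0](\<lambda>_. 1)"
proof (induction \<tau> arbitrary: i)
  case Bullet
  then have "(\<lambda>h. xi m i (\<i> * of_real \<omega> * of_real h)) \<in> O[at_right 0](\<lambda>_. 1)"
    using assms by (intro even_holomorphic_bigo_1) (simp add: admissible_coeffs_def)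
  then show ?case
    by (auto intro: landau_o.big.mult_in_1)
next
  case Tau2
  then show ?case
    using assms unfolding stage_weight.simps
    by (intro big_sum_in_bigo even_holomorphic_bigo_1) (simp add: admissible_coeffs_def)
next
  case (Bracket M)
  have "(\<lambda>h. \<Prod>\<tau>\<in>#M. stage_weight m (\<i> * of_real \<omega> * of_real h) \<tau> j) \<in> O[at_right 0](\<lambda>_. 1)"
    if j: "j \<in> {1..i}" for j
  proof -
    have "(\<lambda>h. stage_weight m (\<i> * of_real \<omega> * of_real h) \<tau> j) \<in> O[at_right 0](\<lambda>_. 1)"
      if "\<tau> \<in> set_mset M" for \<tau>
      using Bracket.IH[OF that, of j] Bracket.prems j by simp
    then show ?thesis
      by (induction M) (auto intro: landau_o.big.mult_in_1)
  qed
  moreover have "(\<lambda>h. acoef m i j (\<i> * of_real \<omega> * of_real h)) \<in> O[at_right 0](\<lambda>_. 1)"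
    if "j \<in> {1..i}" for j
    using assms Bracket.prems that
    by (intro even_holomorphic_bigo_1) (simp add: admissible_coeffs_def)
  ultimately show ?case
    by (auto simp: multiset.map_comp o_def intro!: big_sum_in_bigo landau_o.big.mult_in_1)
qed

lemma elem_weight_bigo_1:
  assumes "admissible_coeffs m"
  shows "(\<lambda>h. elem_weight m (\<i> * of_real \<omega> * of_real h) \<tau>) \<in> O[at_right 0](\<lambda>_. 1)"
proof -
  have b: "(\<lambda>h. bcoef m i (\<i> * of_real \<omega> * of_real h)) \<in> O[at_right 0](\<lambda>_. 1)"
    if "i \<in> {1..stages m}" for i
    using assms that by (intro even_holomorphic_bigo_1) (simp add: admissible_coeffs_def)
  have "(\<lambda>h. \<Prod>\<tau>\<in>#M. stage_weight m (\<i> * of_real \<omega> * of_real h) \<tau> i) \<in> O[at_right 0](\<lambda>_. 1)"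
    if "i \<in> {1..stages m}" for i M
    by (induction M) (auto intro: landau_o.big.mult_in_1 stage_weight_bigo_1[OF assms that])
  with b show ?thesis
    by (cases \<tau>) (auto intro!: big_sum_in_bigo landau_o.big.mult_in_1)
qed

lemma stage_curve_bigo_1:
  assumes "admissible_coeffs m" and "i \<in> {1..stages m}"
  shows "(\<lambda>h. stage_curve m \<omega> i h \<tau>) \<in> O[at_right 0](\<lambda>_. 1)"
  unfolding stage_curve_def using power_bigo_at_right_0[of 0]
  by (intro landau_o.big.mult_in_1 stage_weight_bigo_1 assms) simp

lemma exact_curve_bigo_1: "(\<lambda>h. exact_curve h \<tau>) \<in> O[at_right 0](\<lambda>_. 1)"
  unfolding exact_curve_def divide_inverse using power_bigo_at_right_0[of 0]
  by (intro landau_o.big.mult_in_1) simp_all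

text \<open>\<open>a\<close>, \<open>V i h\<close>, \<open>Z h\<close> stand for \<open>y x\<^sub>n\<close>, \<open>Y\<^sub>i - y x\<^sub>n\<close>, \<open>y (x\<^sub>n + h) - y x\<^sub>n\<close>; \<open>Z'\<close> is the
  velocity, and \<open>\<phi> k\<close> is the \<open>k\<close>-th component of \<open>g\<close>.\<close>

locale tddirk_step =
  fixes m :: tddirk and \<omega> :: real and r :: nat
    and U :: "(real^'n) set" and a :: "real^'n" and \<phi> :: "'n \<Rightarrow> real^'n \<Rightarrow> complex"
    and V :: "nat \<Rightarrow> real \<Rightarrow> real^'n"
    and Z :: "real \<Rightarrow> real^'n" and Z' :: "'n \<Rightarrow> real \<Rightarrow> complex" and \<delta> :: real
  assumes adm: "admissible_coeffs m"
    and U: "open U" "a \<in> U"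
    and \<phi>: "\<And>k. C_k_on r (\<phi> k) U"
    and V_lim: "\<And>i. i \<in> {1..stages m} \<Longrightarrow> (V i \<longlongrightarrow> 0) (at_right 0)"
    and V_eq: "eventually (\<lambda>h. \<forall>i\<in>{1..stages m}. \<forall>k. complex_of_real (V i h $ k) =
      xi m i (\<i> * of_real \<omega> * of_real h) * of_real (node m i) * of_real h * Z' k 0
      + of_real h ^ 2 * (\<Sum>j=1..i. acoef m i j (\<i> * of_real \<omega> * of_real h) * \<phi> k (a + V j h)))
      (at_right 0)"
    and \<delta>: "\<delta> > 0" and Z_0: "Z 0 = 0"
    and Z_cont: "\<And>k. continuous_on {0..\<delta>} (\<lambda>t. complex_of_real (Z t $ k))"
      "\<And>k. continuous_on {0..\<delta>} (Z' k)"
    and Z_der: "\<And>k t. 0 < t \<Longrightarrow> t < \<delta> \<Longrightarrow>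
        ((\<lambda>t. complex_of_real (Z t $ k)) has_vector_derivative Z' k t) (at t)"
      "\<And>k t. 0 < t \<Longrightarrow> t < \<delta> \<Longrightarrow> (Z' k has_vector_derivative \<phi> k (a + Z t)) (at t)"
begin

abbreviation "\<mu> h \<equiv> \<i> * complex_of_real \<omega> * complex_of_real h"

lemma coeffs_bigo_1:
  assumes "i \<in> {1..stages m}"
  shows "(\<lambda>h. xi m i (\<mu> h)) \<in> O[at_right 0](\<lambda>_. 1)"
    and "(\<lambda>h. bcoef m i (\<mu> h)) \<in> O[at_right 0](\<lambda>_. 1)"
    and "j \<in> {1..i} \<Longrightarrow> (\<lambda>h. acoef m i j (\<mu> h)) \<in> O[at_right 0](\<lambda>_. 1)"
  using adm assms by (auto simp: admissible_coeffs_def intro!: even_holomorphic_bigo_1)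

section \<open>Common expansion of the stages and the exact solution in tree weights\<close>

lemma Z_bigo: "(\<lambda>h. complex_of_real (Z h $ k)) \<in> O[at_right 0](\<lambda>h. of_real h)"
proof -
  have "(Z' k \<longlongrightarrow> Z' k 0) (at_right 0)"
    using continuous_on_Icc_at_rightD[OF Z_cont(2) \<delta>] .
  then have "Z' k \<in> O[at_right 0](\<lambda>h. of_real h ^ 0)"
    using tendsto_imp_bigo_1 by fastforce
  from bigo_of_vector_derivative[OF \<delta> Z_cont(1) _ Z_der(1) this] show ?thesis
    by (simp add: Z_0)
qed

text \<open>Convergence of the stages carries no rate, but it bounds \<open>\<phi> k\<close> at the
  stages. Inserting this bound into the stage equations yields the rate \<open>O(h)\<close>.\<close>

lemma V_bigo:
  assumes i: "i \<in> {1..stages m}"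
  shows "(\<lambda>h. complex_of_real (V i h $ k)) \<in> O[at_right 0](\<lambda>h. of_real h)"
proof -
  have "(\<lambda>h. \<phi> k (a + V j h)) \<in> O[at_right 0](\<lambda>_. 1)" if "j \<in> {1..i}" for j
  proof -
    have "isCont (\<phi> k) a"
      using C_k_on_mono[OF le0 \<phi>[of k]] U by (simp add: continuous_on_eq_continuous_at)
    moreover have "((\<lambda>h. a + V j h) \<longlongrightarrow> a + 0) (at_right 0)"
      using that i by (intro tendsto_intros V_lim) simp
    ultimately show ?thesis
      by (intro tendsto_imp_bigo_1[of _ "\<phi> k a"] isCont_tendsto_compose[of a "\<phi> k"]) simp_all
  qed
  then have "(\<lambda>h. \<Sum>j=1..i. acoef m i j (\<mu> h) * \<phi> k (a + V j h)) \<in> O[at_right 0](\<lambda>_. 1)"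
    using i by (intro big_sum_in_bigo landau_o.big.mult_in_1 coeffs_bigo_1)
  then have "(\<lambda>h. of_real h ^ 2 * (\<Sum>j=1..i. acoef m i j (\<mu> h) * \<phi> k (a + V j h)))
      \<in> O[at_right 0](\<lambda>h. of_real h ^ 1 * 1)"
    by (intro landau_o.big.mult power_bigo_at_right_0) simp_all
  moreover have "(\<lambda>h. (xi m i (\<mu> h) * of_real (node m i) * Z' k 0) * of_real h)
      \<in> O[at_right 0](\<lambda>h. 1 * of_real h)"
    using i by (intro landau_o.big.mult landau_o.big.mult_in_1 coeffs_bigo_1) simp_all
  ultimately have "(\<lambda>h. xi m i (\<mu> h) * of_real (node m i) * of_real h * Z' k 0
      + of_real h ^ 2 * (\<Sum>j=1..i. acoef m i j (\<mu> h) * \<phi> k (a + V j h)))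
      \<in> O[at_right 0](\<lambda>h. of_real h)"
    by (intro sum_in_bigo) (simp_all add: mult_ac)
  moreover have "eventually (\<lambda>h. complex_of_real (V i h $ k) =
      xi m i (\<mu> h) * of_real (node m i) * of_real h * Z' k 0
      + of_real h ^ 2 * (\<Sum>j=1..i. acoef m i j (\<mu> h) * \<phi> k (a + V j h))) (at_right 0)"
    using V_eq by eventually_elim (use i in blast)
  ultimately show ?thesis
    by (rule bigo_eventually_eq)
qed

text \<open>The same combinations \<open>\<Theta> k\<close> must fit every stage and the exact
  solution; only the weights inserted differ.\<close>

definition expansion :: "nat \<Rightarrow> ('n \<Rightarrow> (bctree \<Rightarrow> complex) \<Rightarrow> complex) \<Rightarrow> bool" where
  "expansion q \<Theta> \<longleftrightarrow> (\<forall>k. lin_fun BT (\<Theta> k) \<and>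
     (\<forall>i\<in>{1..stages m}. (\<lambda>h. complex_of_real (V i h $ k) - \<Theta> k (stage_curve m \<omega> i h))
        \<in> O[at_right 0](\<lambda>h. of_real h ^ q)) \<and>
     (\<lambda>h. complex_of_real (Z h $ k) - \<Theta> k (exact_curve h)) \<in> O[at_right 0](\<lambda>h. of_real h ^ q))"

text \<open>The Taylor polynomial of \<open>\<phi> k\<close> is composed with the combinations
  \<open>\<Theta>\<close>. Its own remainder is \<open>O(h ^ r)\<close>, hence the restriction
  \<open>q \<le> r\<close>.\<close>

lemma field_expansion:
  assumes "expansion q \<Theta>" and "q \<le> r"
  obtains P where "poly_fun BT P"
    and "\<And>i. i \<in> {1..stages m} \<Longrightarrow> (\<lambda>h. \<phi> k (a + V i h) - P (stage_curve m \<omega> i h))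
      \<in> O[at_right 0](\<lambda>h. of_real h ^ q)"
    and "(\<lambda>h. \<phi> k (a + Z h) - P (exact_curve h)) \<in> O[at_right 0](\<lambda>h. of_real h ^ q)"
proof -
  obtain R where R: "poly_fun UNIV R" and taylor:
    "\<And>v. (\<And>b. (\<lambda>h. complex_of_real (v h $ b)) \<in> O[at_right 0](\<lambda>h. of_real h)) \<Longrightarrow>
      (\<lambda>h. \<phi> k (a + v h) - R (\<lambda>b. of_real (v h $ b))) \<in> O[at_right 0](\<lambda>h. of_real h ^ r)"
    using C_k_on_taylor_bigo[OF U \<phi>[of k]] by blast
  have lin: "lin_fun BT (\<Theta> b)" for b
    using assms(1) by (simp add: expansion_def)
  \<comment> \<open>Stated for arbitrary curves and weights, so that the stages and the exact
    solution share the polynomial \<open>R\<close>.\<close>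
  have *: "(\<lambda>h. \<phi> k (a + v h) - R (\<lambda>b. \<Theta> b (w h))) \<in> O[at_right 0](\<lambda>h. of_real h ^ q)"
    if v: "\<And>b. (\<lambda>h. complex_of_real (v h $ b)) \<in> O[at_right 0](\<lambda>h. of_real h)"
      and w: "\<And>\<tau>. (\<lambda>h. w h \<tau>) \<in> O[at_right 0](\<lambda>_. 1)"
      and vw: "\<And>b. (\<lambda>h. complex_of_real (v h $ b) - \<Theta> b (w h))
        \<in> O[at_right 0](\<lambda>h. of_real h ^ q)"
    for v w
  proof -
    have "(\<lambda>h. complex_of_real (v h $ b)) \<in> O[at_right 0](\<lambda>_. 1)" for b
      using landau_o.big_trans[OF v power_bigo_at_right_0[of 0 1, simplified]] .
    moreover have "(\<lambda>h. \<Theta> b (w h)) \<in> O[at_right 0](\<lambda>_. 1)" for b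
      by (rule poly_fun_in_bigo_1[OF lin_fun_imp_poly_fun[OF lin], where u = w]) (rule w)
    ultimately have "(\<lambda>h. R (\<lambda>b. of_real (v h $ b)) - R (\<lambda>b. \<Theta> b (w h)))
        \<in> O[at_right 0](\<lambda>h. of_real h ^ q)"
      by (intro poly_fun_diff_in_bigo[OF R, where u = "\<lambda>h b. complex_of_real (v h $ b)"
            and w = "\<lambda>h b. \<Theta> b (w h)"] vw)
    from sum_in_bigo(1)[OF bigo_power_mono[OF taylor[OF v] \<open>q \<le> r\<close>] this]
    show ?thesis by simp
  qed
  show thesis
  proof (rule that)
    show "poly_fun BT (\<lambda>w. R (\<lambda>b. \<Theta> b w))"
      by (rule poly_fun_compose[OF R lin_fun_imp_poly_fun[OF lin]])
    show "(\<lambda>h. \<phi> k (a + V i h) - R (\<lambda>b. \<Theta> b (stage_curve m \<omega> i h)))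
        \<in> O[at_right 0](\<lambda>h. of_real h ^ q)" if "i \<in> {1..stages m}" for i
      using assms(1) that
      by (intro *[where v = "V i" and w = "stage_curve m \<omega> i"] V_bigo stage_curve_bigo_1 adm)
        (simp_all add: expansion_def)
    show "(\<lambda>h. \<phi> k (a + Z h) - R (\<lambda>b. \<Theta> b (exact_curve h))) \<in> O[at_right 0](\<lambda>h. of_real h ^ q)"
      using assms(1) by (intro *[where v = Z and w = exact_curve] Z_bigo exact_curve_bigo_1)
        (simp add: expansion_def)
  qed
qed

text \<open>One pass of a fixed point iteration: the factor \<open>h ^ 2\<close> in the method,
  respectively the twofold integration, raises the accuracy from \<open>q\<close> to
  \<open>q + 2\<close>. The numerical increment is expanded in the same pass because it must share
  \<open>Q\<close> with the exact solution.\<close>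

lemma expansion_step:
  assumes "expansion q \<Theta>" and "q \<le> r"
  obtains Q where "expansion (q + 2) Q"
    and "\<And>k. (\<lambda>h. of_real h * Z' k 0
      + of_real h ^ 2 * (\<Sum>i=1..stages m. bcoef m i (\<mu> h) * \<phi> k (a + V i h))
      - Q k (final_curve m \<omega> h)) \<in> O[at_right 0](\<lambda>h. of_real h ^ (q + 2))"
proof -
  have "\<exists>Q. lin_fun BT Q \<and>
     (\<forall>i\<in>{1..stages m}. (\<lambda>h. complex_of_real (V i h $ k) - Q (stage_curve m \<omega> i h))
        \<in> O[at_right 0](\<lambda>h. of_real h ^ (q + 2))) \<and>
     (\<lambda>h. complex_of_real (Z h $ k) - Q (exact_curve h))
       \<in> O[at_right 0](\<lambda>h. of_real h ^ (q + 2)) \<and>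
     (\<lambda>h. of_real h * Z' k 0
        + of_real h ^ 2 * (\<Sum>i=1..stages m. bcoef m i (\<mu> h) * \<phi> k (a + V i h))
        - Q (final_curve m \<omega> h)) \<in> O[at_right 0](\<lambda>h. of_real h ^ (q + 2))" for k
  proof -
    obtain P where P: "poly_fun BT P"
      and PV: "\<And>i. i \<in> {1..stages m} \<Longrightarrow> (\<lambda>h. \<phi> k (a + V i h) - P (stage_curve m \<omega> i h))
        \<in> O[at_right 0](\<lambda>h. of_real h ^ q)"
      and PZ: "(\<lambda>h. \<phi> k (a + Z h) - P (exact_curve h)) \<in> O[at_right 0](\<lambda>h. of_real h ^ q)"
      by (rule field_expansion[OF assms, where k = k]) (rule that)
    obtain Q e where Q: "lin_fun BT Q"
      and st: "\<And>h i. Q (stage_curve m \<omega> i h) = of_real h ^ 2 *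
        (\<Sum>j=1..i. acoef m i j (\<mu> h) * P (stage_curve m \<omega> j h))"
      and fi: "\<And>h. Q (final_curve m \<omega> h) = of_real h ^ 2 *
        (\<Sum>i=1..stages m. bcoef m i (\<mu> h) * P (stage_curve m \<omega> i h))"
      and Q0: "Q (exact_curve 0) = 0" "e 0 = 0"
      and dQ: "\<And>t. ((\<lambda>t. Q (exact_curve t)) has_vector_derivative e t) (at t)"
      and de: "\<And>t. (e has_vector_derivative P (exact_curve t)) (at t)"
      by (rule tree_lift[OF P, where m = m and \<omega> = \<omega>]) (rule that)
    \<comment> \<open>\<open>Bullet\<close> carries the term linear in \<open>h\<close>: its weight
      is \<open>h * xi * c\<close> in a stage and \<open>h\<close> in both the numerical and the
      exact increment.\<close>
    let ?Q = "\<lambda>w. Q w + Z' k 0 * w Bullet"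
    have sq: "(\<lambda>h. of_real h ^ 2 * u h) \<in> O[at_right 0](\<lambda>h. of_real h ^ (q + 2))"
      if "u \<in> O[at_right 0](\<lambda>h. of_real h ^ q)" for u :: "real \<Rightarrow> complex"
      using landau_o.big.mult_left[OF that, of "\<lambda>h. of_real h ^ 2"]
      by (simp flip: power_add del: power_Suc)
    have "lin_fun BT ?Q"
      by (intro lin_fun.add_var Q BT.Bullet)
    moreover have "(\<lambda>h. complex_of_real (V i h $ k) - ?Q (stage_curve m \<omega> i h))
        \<in> O[at_right 0](\<lambda>h. of_real h ^ (q + 2))" if i: "i \<in> {1..stages m}" for i
    proof -
      have "(\<lambda>h. acoef m i j (\<mu> h) * (\<phi> k (a + V j h) - P (stage_curve m \<omega> j h)))
          \<in> O[at_right 0](\<lambda>h. of_real h ^ q)" if "j \<in> {1..i}" for j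
        using landau_o.big.mult[OF coeffs_bigo_1(3)[OF i that] PV[of j]] that i by simp
      then have "(\<lambda>h. of_real h ^ 2 *
          (\<Sum>j=1..i. acoef m i j (\<mu> h) * (\<phi> k (a + V j h) - P (stage_curve m \<omega> j h))))
          \<in> O[at_right 0](\<lambda>h. of_real h ^ (q + 2))"
        by (intro sq big_sum_in_bigo)
      moreover have "eventually (\<lambda>h. complex_of_real (V i h $ k) - ?Q (stage_curve m \<omega> i h) =
          of_real h ^ 2 *
          (\<Sum>j=1..i. acoef m i j (\<mu> h) * (\<phi> k (a + V j h) - P (stage_curve m \<omega> j h)))) (at_right 0)"
        using V_eq
      proof eventually_elim
        case (elim h)
        then have eq: "complex_of_real (V i h $ k) =
            xi m i (\<mu> h) * of_real (node m i) * of_real h * Z' k 0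
            + of_real h ^ 2 * (\<Sum>j=1..i. acoef m i j (\<mu> h) * \<phi> k (a + V j h))"
          using i by blast
        show ?case
          unfolding eq st
          by (simp add: stage_curve_def right_diff_distrib sum_subtractf mult_ac)
      qed
      ultimately show ?thesis
        by (rule bigo_eventually_eq)
    qed
    moreover have "(\<lambda>h. complex_of_real (Z h $ k) - ?Q (exact_curve h))
        \<in> O[at_right 0](\<lambda>h. of_real h ^ (q + 2))"
    proof -
      have contQ: "continuous_on {0..\<delta>} (\<lambda>t. Q (exact_curve t))" "continuous_on {0..\<delta>} e"
        by (intro continuous_at_imp_continuous_on ballI has_vector_derivative_continuous[OF dQ]
            has_vector_derivative_continuous[OF de])+
      \<comment> \<open>The first integration treats the velocity: this difference vanishes at 0,
        and its derivative is the error of the expansion of \<open>\<phi> k\<close> along the exact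
        solution. The second integration then treats \<open>Z\<close>.\<close>
      have "(\<lambda>t. Z' k t - (e t + Z' k 0)) \<in> O[at_right 0](\<lambda>h. of_real h ^ Suc q)"
      proof (rule bigo_of_vector_derivative[OF \<delta> _ _ _ PZ])
        show "((\<lambda>t. Z' k t - (e t + Z' k 0)) has_vector_derivative
            \<phi> k (a + Z t) - P (exact_curve t)) (at t)" if "0 < t" "t < \<delta>" for t
          using has_vector_derivative_diff[OF Z_der(2)[OF that]
              has_vector_derivative_add[OF de has_vector_derivative_const]] by simp
      qed (auto intro!: continuous_intros Z_cont contQ simp: Q0)
      then have "(\<lambda>t. complex_of_real (Z t $ k) - (Q (exact_curve t) + of_real t * Z' k 0))
          \<in> O[at_right 0](\<lambda>h. of_real h ^ Suc (Suc q))"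
      proof (rule bigo_of_vector_derivative[OF \<delta>, rotated -1])
        have "((\<lambda>t. of_real t * Z' k 0) has_vector_derivative Z' k 0) (at t)" for t
          using has_vector_derivative_power_Suc_div[of 0 "Z' k 0"] by simp
        then show "((\<lambda>t. complex_of_real (Z t $ k) - (Q (exact_curve t) + of_real t * Z' k 0))
            has_vector_derivative Z' k t - (e t + Z' k 0)) (at t)" if "0 < t" "t < \<delta>" for t
          by (intro has_vector_derivative_diff has_vector_derivative_add dQ Z_der(1) that)
      qed (auto intro!: continuous_intros Z_cont contQ simp: Q0 Z_0)
      then show ?thesis
        by (simp add: exact_curve_def mult_ac)
    qed
    moreover have "(\<lambda>h. of_real h * Z' k 0
        + of_real h ^ 2 * (\<Sum>i=1..stages m. bcoef m i (\<mu> h) * \<phi> k (a + V i h))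
        - ?Q (final_curve m \<omega> h)) \<in> O[at_right 0](\<lambda>h. of_real h ^ (q + 2))"
    proof -
      have "(\<lambda>h. bcoef m i (\<mu> h) * (\<phi> k (a + V i h) - P (stage_curve m \<omega> i h)))
          \<in> O[at_right 0](\<lambda>h. of_real h ^ q)" if "i \<in> {1..stages m}" for i
        using landau_o.big.mult[OF coeffs_bigo_1(2)[OF that] PV[OF that]] by simp
      then have "(\<lambda>h. of_real h ^ 2 * (\<Sum>i=1..stages m.
          bcoef m i (\<mu> h) * (\<phi> k (a + V i h) - P (stage_curve m \<omega> i h))))
          \<in> O[at_right 0](\<lambda>h. of_real h ^ (q + 2))"
        by (intro sq big_sum_in_bigo)
      then show ?thesis
        unfolding fi by (simp add: final_curve_def right_diff_distrib sum_subtractf mult_ac)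
    qed
    ultimately show ?thesis by blast
  qed
  then have "\<forall>k. \<exists>Q. lin_fun BT Q \<and>
     (\<forall>i\<in>{1..stages m}. (\<lambda>h. complex_of_real (V i h $ k) - Q (stage_curve m \<omega> i h))
        \<in> O[at_right 0](\<lambda>h. of_real h ^ (q + 2))) \<and>
     (\<lambda>h. complex_of_real (Z h $ k) - Q (exact_curve h))
       \<in> O[at_right 0](\<lambda>h. of_real h ^ (q + 2)) \<and>
     (\<lambda>h. of_real h * Z' k 0
        + of_real h ^ 2 * (\<Sum>i=1..stages m. bcoef m i (\<mu> h) * \<phi> k (a + V i h))
        - Q (final_curve m \<omega> h)) \<in> O[at_right 0](\<lambda>h. of_real h ^ (q + 2))" by blast
  then show thesis
    unfolding choice_iff using that by (auto simp: expansion_def)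
qed

text \<open>Each pass gains two powers, of which only one is kept, so that every \<open>q\<close> is
  reached regardless of parity. The start is the zero combination, as all increments are
  bounded.\<close>

lemma expansion_exists: "q \<le> r \<Longrightarrow> \<exists>\<Theta>. expansion q \<Theta>"
proof (induction q)
  case 0
  have "expansion 0 (\<lambda>k w. 0)"
    using landau_o.big_trans[OF V_bigo power_bigo_at_right_0[of 0 1, simplified]]
      landau_o.big_trans[OF Z_bigo power_bigo_at_right_0[of 0 1, simplified]]
    by (simp add: expansion_def lin_fun.zero)
  then show ?case by blast
next
  case (Suc q)
  then obtain \<Theta> where "expansion q \<Theta>" by auto
  then obtain Q where "expansion (q + 2) Q"
    using expansion_step[of q \<Theta>] Suc.prems by auto
  then have "expansion (Suc q) Q"
    unfolding expansion_def
    by (auto intro: bigo_power_mono[where r = "q + 2"] simp del: power_Suc)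
  then show ?case by blast
qed

text \<open>With \<open>p = r + 1\<close>, a last pass from accuracy \<open>r\<close> gives errors
  \<open>O(h ^ (p + 1))\<close>. What remains is \<open>Q k\<close> at the exact weights minus
  \<open>Q k\<close> at the numerical ones, which by linearity is compared tree by tree.\<close>

lemma local_error_bigo:
  assumes order: "\<And>\<tau>. \<tau> \<in> BT \<Longrightarrow> tree_order \<tau> \<le> Suc r \<Longrightarrow>
    (\<lambda>h. elem_weight m (\<mu> h) \<tau> - 1 / of_nat (tree_density \<tau>))
      \<in> O[at_right 0](\<lambda>h. of_real h ^ (Suc r + 1 - tree_order \<tau>))"
  shows "(\<lambda>h. complex_of_real (Z h $ k) - (of_real h * Z' k 0
      + of_real h ^ 2 * (\<Sum>i=1..stages m. bcoef m i (\<mu> h) * \<phi> k (a + V i h))))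
    \<in> O[at_right 0](\<lambda>h. of_real h ^ (r + 2))"
proof -
  obtain \<Theta> where "expansion r \<Theta>"
    using expansion_exists[of r] by blast
  then obtain Q where Q: "expansion (r + 2) Q"
    and final: "(\<lambda>h. of_real h * Z' k 0
      + of_real h ^ 2 * (\<Sum>i=1..stages m. bcoef m i (\<mu> h) * \<phi> k (a + V i h))
      - Q k (final_curve m \<omega> h)) \<in> O[at_right 0](\<lambda>h. of_real h ^ (r + 2))"
    using expansion_step[OF _ order_refl] by blast
  have tree: "(\<lambda>h. exact_curve h \<tau> - final_curve m \<omega> h \<tau>)
      \<in> O[at_right 0](\<lambda>h. of_real h ^ (r + 2))" if "\<tau> \<in> BT" for \<tau>
  proof (cases "tree_order \<tau> \<le> Suc r")
    case True
    have "(\<lambda>h. of_real h ^ tree_order \<tau> *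
        (elem_weight m (\<mu> h) \<tau> - 1 / of_nat (tree_density \<tau>)))
        \<in> O[at_right 0](\<lambda>h. of_real h ^ tree_order \<tau> * of_real h ^ (Suc r + 1 - tree_order \<tau>))"
      by (intro landau_o.big.mult_left order that True)
    then have "(\<lambda>h. - (of_real h ^ tree_order \<tau> *
        (elem_weight m (\<mu> h) \<tau> - 1 / of_nat (tree_density \<tau>))))
        \<in> O[at_right 0](\<lambda>h. of_real h ^ (r + 2))"
      using True by (simp flip: power_add)
    then show ?thesis
      by (simp add: exact_curve_def final_curve_def right_diff_distrib)
  next
    \<comment> \<open>Such a tree has order at least \<open>r + 2\<close>, so the exact and the
      numerical weight are each of the required size by boundedness of the unscaled weights.\<close>
    case False
    have "(\<lambda>h. of_real h ^ tree_order \<tau> *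
        (1 / of_nat (tree_density \<tau>) - elem_weight m (\<mu> h) \<tau>))
        \<in> O[at_right 0](\<lambda>h. of_real h ^ tree_order \<tau> * 1)"
      by (rule landau_o.big.mult_left[OF sum_in_bigo(2)[OF bigo_const elem_weight_bigo_1[OF adm]]])
    then have "(\<lambda>h. of_real h ^ tree_order \<tau> *
        (1 / of_nat (tree_density \<tau>) - elem_weight m (\<mu> h) \<tau>))
        \<in> O[at_right 0](\<lambda>h. of_real h ^ tree_order \<tau>)"
      by (simp only: mult_1_right)
    from bigo_power_mono[OF this, of "r + 2"] False
    have "(\<lambda>h. of_real h ^ tree_order \<tau> *
        (1 / of_nat (tree_density \<tau>) - elem_weight m (\<mu> h) \<tau>))
        \<in> O[at_right 0](\<lambda>h. of_real h ^ (r + 2))"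
      by linarith
    then show ?thesis
      by (simp add: exact_curve_def final_curve_def right_diff_distrib)
  qed
  have "lin_fun BT (Q k)"
    using Q by (simp add: expansion_def)
  then have weights: "(\<lambda>h. Q k (exact_curve h) - Q k (final_curve m \<omega> h))
      \<in> O[at_right 0](\<lambda>h. of_real h ^ (r + 2))"
  proof induction
    case (add_var P \<tau> c)
    have "(\<lambda>h. (P (exact_curve h) - P (final_curve m \<omega> h))
        + c * (exact_curve h \<tau> - final_curve m \<omega> h \<tau>)) \<in> O[at_right 0](\<lambda>h. of_real h ^ (r + 2))"
      using tree[OF add_var.hyps(2)] by (intro sum_in_bigo(1)[OF add_var.IH]) simp
    then show ?case by (simp add: algebra_simps)
  qed simp
  have exact: "(\<lambda>h. complex_of_real (Z h $ k) - Q k (exact_curve h))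
      \<in> O[at_right 0](\<lambda>h. of_real h ^ (r + 2))"
    using Q by (simp add: expansion_def)
  from sum_in_bigo(2)[OF sum_in_bigo(1)[OF exact weights] final] show ?thesis
    by (simp add: algebra_simps)
qed

end

section \<open>Reduction of the consistency order to the expansion of one step\<close>

theorem lemma2p1:
  fixes m :: tddirk and \<omega> :: real and p :: nat
    and f :: "real^'n \<Rightarrow> real^'n" and U :: "(real^'n) set"
    and x0 X :: real and y0 :: "real^'n" and y :: "real \<Rightarrow> real^'n"
  assumes "\<omega> > 0" and "p \<ge> 1"
    and "admissible_coeffs m"
    and "open U" and "C_k_on p f U"
    and "x0 < X" and "solves_ivp f x0 y0 X y" and "y ` {x0..X} \<subseteq> U"
    and "\<forall>\<tau>\<in>BT. tree_order \<tau> \<le> p \<longrightarrow>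
           (\<lambda>h. elem_weight m (\<i> * of_real \<omega> * of_real h) \<tau> - 1 / of_nat (tree_density \<tau>))
             \<in> O[at_right 0](\<lambda>h. of_real h ^ (p + 1 - tree_order \<tau>))"
  shows "has_consistency_order m \<omega> f x0 X y p"
proof -
  \<comment> \<open>One derivative of \<open>f\<close> is spent on forming \<open>g\<close>, which
    is therefore of class \<open>C^r\<close> with \<open>r = p - 1\<close>.\<close>
  obtain r where p: "p = Suc r"
    using \<open>p \<ge> 1\<close> by (cases p) auto
  have f: "C_k_on (Suc r) f U"
    using assms(5) by (simp only: p)
  have "(\<lambda>h. norm (LTE m \<omega> f y xn Y h)) \<in> O[at_right 0](\<lambda>h. h ^ (p + 1))"
    if xn: "xn \<in> {x0..<X}" and Y: "stages_near m \<omega> f (y xn) Y" for xn Y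
  proof -
    let ?L = "\<lambda>k (v :: real^'n). complex_of_real (v $ k)"
    have L: "bounded_linear (?L k)" for k
      by (rule bounded_linear_compose[OF bounded_linear_of_real bounded_linear_vec_nth])
    define \<phi> where "\<phi> k x = ?L k (second_deriv_field f x)" for k x
    define V where "V i h = Y h i - y xn" for i h
    define Z where "Z t = y (xn + t) - y xn" for t
    define Z' where "Z' k t = ?L k (f (y (xn + t)))" for k t
    have y_in_U: "y (xn + t) \<in> U" if "t \<in> {0..X - xn}" for t
      using assms(8) xn that by (auto simp: image_subset_iff)
    have dy: "(y has_vector_derivative f (y x)) (at x within {x0..X})" if "x \<in> {x0..X}" for x
      using assms(7) that by (simp add: solves_ivp_def)
    have y_cont: "continuous_on {0..X - xn} (\<lambda>t. y (xn + t))"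
    proof (rule continuous_on_compose2[of "{x0..X}" y])
      show "continuous_on {x0..X} y"
        using dy by (meson continuous_on_eq_continuous_within has_vector_derivative_continuous)
    qed (use xn in \<open>auto intro!: continuous_intros\<close>)
    have f_cont: "continuous_on U f"
      using C_k_on_mono[OF le0 f] by simp
    \<comment> \<open>For \<open>0 < t\<close> the point lies in the interior of
      \<open>{x0..X}\<close>, even if \<open>xn = x0\<close>, so the one-sided derivative is a full
      one.\<close>
    have y_shift: "((\<lambda>t. y (xn + t)) has_vector_derivative f (y (xn + t))) (at t)"
      if t: "0 < t" "t < X - xn" for t
    proof -
      have "xn + t \<in> {x0<..<X}"
        using xn t by auto
      then have "(y has_vector_derivative f (y (xn + t))) (at (xn + t))"
        using dy[of "xn + t"] by (simp add: at_within_Icc_at)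
      moreover have "((\<lambda>t. xn + t) has_vector_derivative 1) (at t)"
        by (auto intro!: derivative_eq_intros)
      ultimately show ?thesis
        using vector_diff_chain_at by (fastforce simp: o_def)
    qed
    \<comment> \<open>By the chain rule this is the equation \<open>y'' = g y\<close>.\<close>
    have g_der: "((\<lambda>t. f (y (xn + t))) has_vector_derivative second_deriv_field f (y (xn + t)))
        (at t)" if t: "0 < t" "t < X - xn" for t
    proof -
      have "y (xn + t) \<in> U"
        using y_in_U t by simp
      from vector_derivative_diff_chain_within[OF y_shift[OF t]
          has_derivative_at_withinI[OF C_k_on_Suc_has_derivative[OF f this]]]
      show ?thesis by (simp add: o_def second_deriv_field_def)
    qed
    interpret tddirk_step m \<omega> r U "y xn" \<phi> V Z Z' "X - xn"
    proof
      show "admissible_coeffs m" "open U" by fact+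
      show "y xn \<in> U" "X - xn > 0" "Z 0 = 0"
        using y_in_U[of 0] xn by (simp_all add: Z_def)
      show "C_k_on r (\<phi> k) U" for k
        unfolding \<phi>_def by (rule C_k_on_second_deriv_field[OF assms(4) f])
      show "(V i \<longlongrightarrow> 0) (at_right 0)" if "i \<in> {1..stages m}" for i
        using Y that unfolding V_def[abs_def] stages_near_def by (simp add: LIM_zero)
      show "continuous_on {0..X - xn} (\<lambda>t. ?L k (Z t))" for k
        unfolding Z_def by (intro bounded_linear.continuous_on[OF L] continuous_intros y_cont)
      show "continuous_on {0..X - xn} (Z' k)" for k
        unfolding Z'_def[abs_def] using y_in_U
        by (intro bounded_linear.continuous_on[OF L] continuous_on_compose2[OF f_cont y_cont]) auto
      show "((\<lambda>t. ?L k (Z t)) has_vector_derivative Z' k t) (at t)" if "0 < t" "t < X - xn" for k t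
        unfolding Z_def Z'_def
        using has_vector_derivative_diff[OF y_shift[OF that] has_vector_derivative_const]
        by (intro bounded_linear.has_vector_derivative[OF L]) simp
      show "(Z' k has_vector_derivative \<phi> k (y xn + Z t)) (at t)" if "0 < t" "t < X - xn" for k t
        unfolding Z_def Z'_def[abs_def] \<phi>_def
        using bounded_linear.has_vector_derivative[OF L g_der[OF that]] by simp
      have "eventually (\<lambda>h. stage_equations m \<omega> f (y xn) h (Y h)) (at_right 0)"
        using Y by (simp add: stages_near_def)
      then show "eventually (\<lambda>h. \<forall>i\<in>{1..stages m}. \<forall>k. complex_of_real (V i h $ k) =
        xi m i (\<i> * of_real \<omega> * of_real h) * of_real (node m i) * of_real h * Z' k 0
        + of_real h ^ 2 * (\<Sum>j=1..i. acoef m i j (\<i> * of_real \<omega> * of_real h) *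
            \<phi> k (y xn + V j h))) (at_right 0)"
      proof eventually_elim
        case (elim h)
        then show ?case
          by (auto simp: stage_equations_def Let_def vec_eq_iff cvec_def V_def Z'_def \<phi>_def)
      qed
    qed
    have comp: "(\<lambda>h. LTE m \<omega> f y xn Y h $ k) \<in> O[at_right 0](\<lambda>h. of_real h ^ (p + 1))" for k
    proof -
      have "(\<lambda>h. complex_of_real (Z h $ k) - (of_real h * Z' k 0
          + of_real h ^ 2 * (\<Sum>i=1..stages m. bcoef m i (\<mu> h) * \<phi> k (y xn + V i h))))
          \<in> O[at_right 0](\<lambda>h. of_real h ^ (r + 2))"
        using assms(9) by (intro local_error_bigo) (simp add: p)
      moreover have "LTE m \<omega> f y xn Y h $ k = complex_of_real (Z h $ k) - (of_real h * Z' k 0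
          + of_real h ^ 2 * (\<Sum>i=1..stages m. bcoef m i (\<mu> h) * \<phi> k (y xn + V i h)))" for h
        by (simp add: LTE_def next_value_def Let_def cvec_def Z_def Z'_def \<phi>_def V_def)
      ultimately show ?thesis by (simp add: p)
    qed
    have "(\<lambda>h. norm (LTE m \<omega> f y xn Y h $ k)) \<in> O[at_right 0](\<lambda>h. h ^ (p + 1))" for k
    proof -
      obtain c where "eventually (\<lambda>h. norm (LTE m \<omega> f y xn Y h $ k)
          \<le> c * norm (of_real h ^ (p + 1) :: complex)) (at_right 0)"
        using comp[of k] by (elim landau_o.bigE)
      then have "eventually (\<lambda>h. norm (norm (LTE m \<omega> f y xn Y h $ k))
          \<le> c * norm (h ^ (p + 1))) (at_right 0)"
        by (simp only: norm_power norm_of_real real_norm_def abs_norm_cancel power_abs)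
      then show ?thesis by (rule bigoI)
    qed
    then have sum: "(\<lambda>h. \<Sum>k\<in>UNIV. norm (LTE m \<omega> f y xn Y h $ k)) \<in> O[at_right 0](\<lambda>h. h ^ (p + 1))"
      by (intro big_sum_in_bigo)
    \<comment> \<open>The Euclidean norm is at most the sum of the moduli of the components, so the
      componentwise bounds suffice.\<close>
    have "norm (norm (LTE m \<omega> f y xn Y h))
        \<le> norm (\<Sum>k\<in>UNIV. norm (LTE m \<omega> f y xn Y h $ k))" for h
      by (simp add: norm_vec_def L2_set_le_sum sum_nonneg)
    then have "(\<lambda>h. norm (LTE m \<omega> f y xn Y h))
        \<in> O[at_right 0](\<lambda>h. \<Sum>k\<in>UNIV. norm (LTE m \<omega> f y xn Y h $ k))"
      by (intro landau_o.big_mono always_eventually allI)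
    from landau_o.big_trans[OF this sum] show ?thesis .
  qed
  then show ?thesis
    by (simp add: has_consistency_order_def)
qed

end
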